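(* Let $\alpha\in(\tfrac12,1)$, $s=p^{1-\alpha}$, and $A=\sqrt{2r\log p/n}$ with $r>\alpha$. Assume either $\mathbf X\in\mathrm{SubG}(\sigma^2)$ with $n/p^{3/2}\to\infty$, or $\mathbf X\in\mathcal O_n(p)$ with $n\ge p$. For $t\in\mathbb R$ let $\xi(t)=\mathbf 1\big(\max_{j\in[p]}|z_j|>t\big)$. Then $$\liminf_{p\to\infty}\frac{\log\inf_{t}\mathrm{Risk}(\xi(t),s,A)}{s\log p}>-\frac{(r-\alpha)^2}{4r}.$$
   Context: Setting: for each $p$ one observes $(\mathbf y,\mathbf X)$ with $\mathbf y=\mathbf X\boldsymbol\beta+\boldsymbol\varepsilon$, where $\boldsymbol\varepsilon\sim\mathcal N(0,I_n)$, $\mathbf X$ is an $n\times p$ real matrix independent of $\boldsymbol\varepsilon$, $\boldsymbol\beta\in\mathbb R^p$ is unknown, and $n=n(p)\to\infty$ as $p\to\infty$. Design classes: $\mathbf X\in\mathrm{SubG}(\sigma^2)$ means the rows of $\mathbf X$ are i.i.d. centered isotropic ($\mathbb E[xx^T]=I_p$) sub-Gaussian random vectors with sub-Gaussian parameter $\sigma^2$ (for every unit $u$ and $t\in\mathbb R$, $\log\mathbb E e^{t\langle u,x\rangle}\le\sigma^2t^2/2$), and $\mathbf X^T\mathbf X$ is almost surely positive definite; $\mathbf X\in\mathcal O_n(p)$ means $\mathbf X^T\mathbf X=nI_p$. For an integer $s$ and $A>0$, $\Xi(s,A)=\{\boldsymbol\beta\in\mathbb R^p:|\mathrm{supp}(\boldsymbol\beta)|=s,\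 |\beta_i|\ge A\text{ for }i\in\mathrm{supp}(\boldsymbol\beta)\}$. A test $T$ is a measurable $[0,1]$-valued function of $(\mathbf y,\mathbf X)$; $\mathbb E_{\boldsymbol\beta}$ denotes expectation over $(\mathbf y,\mathbf X)$ under parameter $\boldsymbol\beta$, $\mathbb E_0$ under $\boldsymbol\beta=0$. $\mathrm{Risk}(T,s,A)=\mathbb E_0[T]+\sup_{\boldsymbol\beta\in\Xi(s,A)}\mathbb E_{\boldsymbol\beta}[1-T]$. The vector $\mathbf z=(z_1,\dots,z_p)=(\mathbf X^T\mathbf X)^{-1/2}\mathbf X^T\mathbf y$, where $(\mathbf X^T\mathbf X)^{-1/2}=OD^{-1/2}O^T$ for a spectral decomposition $\mathbf X^T\mathbf X=ODO^T$. *)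

theory Defs
  imports "HOL-Probability.Probability" "Jordan_Normal_Form.Matrix"
begin

definition posdef_mat :: "real mat \<Rightarrow> bool" where
  "posdef_mat G \<longleftrightarrow> (\<exists>k. G \<in> carrier_mat k k \<and> transpose_mat G = G \<and>
     (\<forall>v \<in> carrier_vec k. v \<noteq> 0\<^sub>v k \<longrightarrow> v \<bullet> (G *\<^sub>v v) > 0))"

definition inv_sqrt_mat :: "real mat \<Rightarrow> real mat" where
  "inv_sqrt_mat G = (if posdef_mat G then
     (SOME M. \<exists>Q D. Q \<in> carrier_mat (dim_row G) (dim_row G) \<and>
                   D \<in> carrier_mat (dim_row G) (dim_row G) \<and>
                   transpose_mat Q * Q = 1\<^sub>m (dim_row G) \<and> diagonal_mat D \<and>
                   G = Q * D * transpose_mat Q \<and>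
                   M = Q * mat (dim_row G) (dim_row G)
                         (\<lambda>(i,j). if i = j then 1 / sqrt (D $$ (i,i)) else 0) * transpose_mat Q)
   else 0\<^sub>m (dim_row G) (dim_col G))"

definition z_stat :: "real mat \<Rightarrow> real vec \<Rightarrow> real vec" where
  "z_stat X y = inv_sqrt_mat (transpose_mat X * X) *\<^sub>v (transpose_mat X *\<^sub>v y)"

definition xi_test :: "real \<Rightarrow> real vec \<Rightarrow> real mat \<Rightarrow> real" where
  "xi_test t y X = (if (\<exists>j < dim_vec (z_stat X y). \<bar>vec_index (z_stat X y) j\<bar> > t) then 1 else 0)"

definition Xi :: "nat \<Rightarrow> nat \<Rightarrow> real \<Rightarrow> real vec set" where
  "Xi p s A = {\<beta>. dim_vec \<beta> = p \<and> card {i. i < p \<and> vec_index \<beta> i \<noteq> 0} = s \<and>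
                  (\<forall>i<p. vec_index \<beta> i \<noteq> 0 \<longrightarrow> \<bar>vec_index \<beta> i\<bar> \<ge> A)}"

definition E_beta :: "'w measure \<Rightarrow> ('w \<Rightarrow> real mat) \<Rightarrow> ('w \<Rightarrow> real vec)
      \<Rightarrow> (real vec \<Rightarrow> real mat \<Rightarrow> real) \<Rightarrow> real vec \<Rightarrow> real" where
  "E_beta M X eps T \<beta> = (\<integral>\<omega>. T (X \<omega> *\<^sub>v \<beta> + eps \<omega>) (X \<omega>) \<partial>M)"

definition Risk :: "'w measure \<Rightarrow> ('w \<Rightarrow> real mat) \<Rightarrow> ('w \<Rightarrow> real vec) \<Rightarrow> nat
      \<Rightarrow> (real vec \<Rightarrow> real mat \<Rightarrow> real) \<Rightarrow> nat \<Rightarrow> real \<Rightarrow> real" where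
  "Risk M X eps p T s A = E_beta M X eps T (0\<^sub>v p)
      + (SUP \<beta> \<in> Xi p s A. E_beta M X eps (\<lambda>y Z. 1 - T y Z) \<beta>)"

text \<open>Basic setup for one value of p: X is a random n x p matrix, eps a random
  vector of n i.i.d. N(0,1) entries, and X is independent of eps.
  (eps is encoded as a function on {..<n} x {0} only so that both random
  elements have the same codomain type, as indep_var requires.)\<close>
definition model_setup :: "'w measure \<Rightarrow> ('w \<Rightarrow> real mat) \<Rightarrow> ('w \<Rightarrow> real vec) \<Rightarrow> nat \<Rightarrow> nat \<Rightarrow> bool" where
  "model_setup M X eps n p \<longleftrightarrow>
     prob_space M \<and>
     (\<forall>\<omega>\<in>space M. X \<omega> \<in> carrier_mat n p \<and> eps \<omega> \<in> carrier_vec n) \<and>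
     prob_space.indep_vars M (\<lambda>_. borel) (\<lambda>i \<omega>. vec_index (eps \<omega>) i) {..<n} \<and>
     (\<forall>i<n. distributed M lborel (\<lambda>\<omega>. vec_index (eps \<omega>) i) (\<lambda>x. ennreal (std_normal_density x))) \<and>
     prob_space.indep_var M
        (PiM ({..<n} \<times> {..<p}) (\<lambda>_. borel)) (\<lambda>\<omega>. restrict (\<lambda>(i,j). X \<omega> $$ (i,j)) ({..<n} \<times> {..<p}))
        (PiM ({..<n} \<times> {0}) (\<lambda>_. borel))
        (\<lambda>\<omega>. restrict (\<lambda>(i,_). vec_index (eps \<omega>) i) ({..<n} \<times> {0}))"

definition row_rv :: "('w \<Rightarrow> real mat) \<Rightarrow> nat \<Rightarrow> nat \<Rightarrow> 'w \<Rightarrow> nat \<Rightarrow> real" where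
  "row_rv X p i \<omega> = restrict (\<lambda>j. X \<omega> $$ (i,j)) {..<p}"

definition SubG :: "'w measure \<Rightarrow> ('w \<Rightarrow> real mat) \<Rightarrow> nat \<Rightarrow> nat \<Rightarrow> real \<Rightarrow> bool" where
  "SubG M X n p \<sigma>2 \<longleftrightarrow>
     prob_space.indep_vars M (\<lambda>_. PiM {..<p} (\<lambda>_. borel)) (row_rv X p) {..<n} \<and>
     (\<forall>i<n. distr M (PiM {..<p} (\<lambda>_. borel)) (row_rv X p i)
            = distr M (PiM {..<p} (\<lambda>_. borel)) (row_rv X p 0)) \<and>
     (\<forall>i<n. \<forall>j<p. integrable M (\<lambda>\<omega>. X \<omega> $$ (i,j)) \<and> (\<integral>\<omega>. X \<omega> $$ (i,j) \<partial>M) = 0) \<and>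
     (\<forall>i<n. \<forall>j<p. \<forall>k<p. integrable M (\<lambda>\<omega>. X \<omega> $$ (i,j) * X \<omega> $$ (i,k)) \<and>
            (\<integral>\<omega>. X \<omega> $$ (i,j) * X \<omega> $$ (i,k) \<partial>M) = (if j = k then 1 else 0)) \<and>
     (\<forall>i<n. \<forall>u::nat \<Rightarrow> real. \<forall>t::real. (\<Sum>j<p. (u j)\<^sup>2) = 1 \<longrightarrow>
            integrable M (\<lambda>\<omega>. exp (t * (\<Sum>j<p. u j * X \<omega> $$ (i,j)))) \<and>
            ln (\<integral>\<omega>. exp (t * (\<Sum>j<p. u j * X \<omega> $$ (i,j))) \<partial>M) \<le> \<sigma>2 * t\<^sup>2 / 2) \<and>
     (AE \<omega> in M. posdef_mat (transpose_mat (X \<omega>) * X \<omega>))"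

definition Orth_design :: "'w measure \<Rightarrow> ('w \<Rightarrow> real mat) \<Rightarrow> nat \<Rightarrow> nat \<Rightarrow> bool" where
  "Orth_design M X n p \<longleftrightarrow>
     (\<forall>\<omega>\<in>space M. transpose_mat (X \<omega>) * X \<omega> = real n \<cdot>\<^sub>m 1\<^sub>m p)"

end

(* The risk of the max test decays more slowly than exp (- c * s * log p) for every c > 0: a
   threshold that makes the type I error that small has order sqrt (s * log p), and at such a
   threshold the max test misses a signal of the form A * (1, ..., 1, 0, ..., 0).

   With G = X^T X one has z = G^(1/2) beta + xi, where xi has standard normal coordinates given X.
   For thresholds up to t0 = delta * sqrt (2 r s log p) + O (sqrt (log p)) the type I error is at
   least P (|N(0,1)| > t0) = exp (- (1 + o(1)) * delta^2 * r * s * log p).  For larger thresholds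
   the type II error is at least 1/2, since with probability at least 1/2
     max_j |z_j| <= sqrt n * max_j |beta_j| + ||(G^(1/2) - sqrt n I) beta|| + max_j |xi_j| <= t0.
   The middle term is at most ||(G - n I) beta|| / sqrt n because G^(1/2) + sqrt n I >= sqrt n I;
   in the sub-Gaussian case Chebyshev's inequality and the fourth moments of the rows bound this
   by delta * sqrt n * ||beta|| as soon as p / n -> 0.  Finally delta is arbitrary. *)

theory Submission
  imports
    Defs
    "Jordan_Normal_Form.Schur_Decomposition"
    "HOL-Real_Asymp.Real_Asymp"
begin

unbundle no vec_syntax and no inner_syntax

section \<open>Spectral theorem for real symmetric matrices\<close>

text \<open>Two points shape the proof. The matrix error in one coordinate is bounded by a full
  Euclidean norm, so the threshold t0 is allowed to grow to order \<delta> * sqrt (2 r s log p), for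
  large p far above the signal level sqrt (2 r log p) of a single coordinate. This crude loss is
  affordable because the log risk is measured against s log p; all that is needed is a coefficient
  \<delta>^2 r below (r - \<alpha>)^2 / (4 r). The other point is that \<open>inv_sqrt_mat\<close>
  picks an eigenbasis by Hilbert choice, separately for each matrix, so that z is not obviously a
  random variable. The spectral theorem shows that there is something to choose, and a binomial
  series in G / tr G - I computes the outcome from the entries of G alone. The resulting
  measurability is what gives meaning to the error probabilities and to the conditioning on X behind
  the normal law of the noise coordinates.\<close>

lemma symmetric_scalar_prod_mult_mat_vec:
  fixes A :: "'a :: comm_semiring_0 mat"
  assumes A: "A \<in> carrier_mat n n" and sym: "transpose_mat A = A"
    and v: "v \<in> carrier_vec n" and w: "w \<in> carrier_vec n"
  shows "v \<bullet> (A *\<^sub>v w) = w \<bullet> (A *\<^sub>v v)"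
proof -
  have "v \<bullet> (A *\<^sub>v w) = (transpose_mat A *\<^sub>v v) \<bullet> w"
    using transpose_vec_mult_scalar[OF A w v] by simp
  then show ?thesis
    unfolding sym using comm_scalar_prod[of "A *\<^sub>v v" n w] A v w by simp
qed

lemma scalar_prod_self_eq_sum_squares:
  fixes v :: "real vec"
  assumes "v \<in> carrier_vec n"
  shows "v \<bullet> v = (\<Sum>i<n. (v $ i)\<^sup>2)"
  using assms by (auto simp: scalar_prod_def power2_eq_square atLeast0LessThan)

lemma scalar_prod_self_nonneg: "0 \<le> (v :: real vec) \<bullet> v"
  by (auto simp: scalar_prod_def intro!: sum_nonneg)

lemma scalar_prod_self_pos:
  fixes v :: "real vec"
  assumes v: "v \<in> carrier_vec n" and "v \<noteq> 0\<^sub>v n"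
  shows "0 < v \<bullet> v"
proof -
  obtain i where i: "i < n" "v $ i \<noteq> 0"
    using assms by (metis carrier_vecD eq_vecI index_zero_vec)
  then show ?thesis
    unfolding scalar_prod_self_eq_sum_squares[OF v]
    by (intro sum_pos2[of _ i]) auto
qed

text \<open>The characteristic polynomial splits over the complex numbers, which gives an
  eigenvector u = x + iy with eigenvalue l. Comparing real and imaginary parts, symmetry of A yields
  Im l * (|x|^2 + |y|^2) = 0, so l is real and whichever of x and y is nonzero is a real
  eigenvector.\<close>

lemma symmetric_real_eigenvector_exists:
  fixes A :: "real mat"
  assumes A: "A \<in> carrier_mat n n" and sym: "transpose_mat A = A" and n: "n > 0"
  obtains e v where "v \<in> carrier_vec n" "v \<noteq> 0\<^sub>v n" "A *\<^sub>v v = e \<cdot>\<^sub>v v"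
proof -
  define C where "C = map_mat complex_of_real A"
  have C: "C \<in> carrier_mat n n" using A by (simp add: C_def)
  obtain as where as: "char_poly C = (\<Prod>a\<leftarrow>as. [:- a, 1:])" "length as = n"
    using char_poly_factorized[OF C] by blast
  from as n obtain l ls where "as = l # ls" by (cases as) auto
  with as have "poly (char_poly C) l = 0" by simp
  then have "eigenvalue C l" by (simp add: eigenvalue_root_char_poly[OF C])
  then obtain u where u: "u \<in> carrier_vec n" "u \<noteq> 0\<^sub>v n" "C *\<^sub>v u = l \<cdot>\<^sub>v u"
    using C unfolding eigenvalue_def eigenvector_def by auto
  define x where "x = map_vec Re u"
  define y where "y = map_vec Im u"
  have x: "x \<in> carrier_vec n" and y: "y \<in> carrier_vec n"
    using u by (auto simp: x_def y_def)
  have eq: "(\<Sum>j = 0..<n. complex_of_real (A $$ (i, j)) * u $ j) = l * u $ i" if "i < n" for i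
    using arg_cong[OF u(3), of "\<lambda>w. w $ i"] that A u(1)
    by (auto simp: C_def scalar_prod_def)
  have Ax: "A *\<^sub>v x = Re l \<cdot>\<^sub>v x - Im l \<cdot>\<^sub>v y"
  proof (rule eq_vecI)
    fix i assume "i < dim_vec (Re l \<cdot>\<^sub>v x - Im l \<cdot>\<^sub>v y)"
    then have i: "i < n" using y by simp
    have "Re (\<Sum>j = 0..<n. complex_of_real (A $$ (i, j)) * u $ j) = Re (l * u $ i)"
      using eq[OF i] by simp
    then show "(A *\<^sub>v x) $ i = (Re l \<cdot>\<^sub>v x - Im l \<cdot>\<^sub>v y) $ i"
      using i A u(1) by (simp add: scalar_prod_def x_def y_def)
  qed (use A y in simp)
  have Ay: "A *\<^sub>v y = Re l \<cdot>\<^sub>v y + Im l \<cdot>\<^sub>v x"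
  proof (rule eq_vecI)
    fix i assume "i < dim_vec (Re l \<cdot>\<^sub>v y + Im l \<cdot>\<^sub>v x)"
    then have i: "i < n" using x by simp
    have "Im (\<Sum>j = 0..<n. complex_of_real (A $$ (i, j)) * u $ j) = Im (l * u $ i)"
      using eq[OF i] by simp
    then show "(A *\<^sub>v y) $ i = (Re l \<cdot>\<^sub>v y + Im l \<cdot>\<^sub>v x) $ i"
      using i A u(1) by (simp add: scalar_prod_def x_def y_def)
  qed (use A x in simp)
  have "x \<noteq> 0\<^sub>v n \<or> y \<noteq> 0\<^sub>v n"
  proof (rule ccontr)
    assume "\<not> ?thesis"
    then have 0: "x = 0\<^sub>v n" "y = 0\<^sub>v n" by auto
    have "u = 0\<^sub>v n"
    proof (rule eq_vecI)
      fix i assume "i < dim_vec (0\<^sub>v n :: complex vec)"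
      then have i: "i < n" by simp
      have "x $ i = 0" "y $ i = 0" using i 0 by auto
      then show "u $ i = 0\<^sub>v n $ i"
        using i u(1) by (simp add: x_def y_def complex_eq_iff)
    qed (use u(1) in simp)
    with u(2) show False by simp
  qed
  moreover have "Im l = 0"
  proof -
    have "x \<bullet> (A *\<^sub>v y) = Re l * (x \<bullet> y) + Im l * (x \<bullet> x)"
      unfolding Ay using x y by (simp add: scalar_prod_add_distrib[of _ n])
    moreover have "y \<bullet> (A *\<^sub>v x) = Re l * (x \<bullet> y) - Im l * (y \<bullet> y)"
      unfolding Ax using x y
      by (simp add: scalar_prod_minus_distrib[of _ n] comm_scalar_prod[of y n x])
    ultimately have "Im l * (x \<bullet> x + y \<bullet> y) = 0"
      using symmetric_scalar_prod_mult_mat_vec[OF A sym x y] by (simp add: algebra_simps)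
    moreover have "x \<bullet> x + y \<bullet> y > 0"
      using \<open>x \<noteq> 0\<^sub>v n \<or> y \<noteq> 0\<^sub>v n\<close> scalar_prod_self_pos[OF x] scalar_prod_self_pos[OF y]
        scalar_prod_self_nonneg[of x] scalar_prod_self_nonneg[of y]
      by (auto simp: add_pos_nonneg add_nonneg_pos)
    ultimately show ?thesis by simp
  qed
  then have "A *\<^sub>v x = Re l \<cdot>\<^sub>v x" "A *\<^sub>v y = Re l \<cdot>\<^sub>v y"
    unfolding Ax Ay using x y by (auto intro!: eq_vecI)
  ultimately show thesis using that x y by blast
qed

text \<open>Complete v to a basis, orthogonalise by Gram-Schmidt, which keeps the first vector, and
  divide each vector by its length. This serves to rotate an eigenvector into the first
  coordinate.\<close>

lemma orthogonal_mat_first_column: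
  fixes v :: "real vec"
  assumes v: "v \<in> carrier_vec n" and v0: "v \<noteq> 0\<^sub>v n"
  obtains W c where "W \<in> carrier_mat n n" "transpose_mat W * W = 1\<^sub>m n" "col W 0 = c \<cdot>\<^sub>v v"
proof -
  have n: "n > 0" using v v0 by (cases n) auto
  define ws where "ws = gram_schmidt n (basis_completion v)"
  interpret cof_vec_space n "TYPE(real)" .
  have b: "set (basis_completion v) \<subseteq> carrier_vec n" "distinct (basis_completion v)"
    "\<not> lin_dep (set (basis_completion v))" "length (basis_completion v) = n"
    "hd (basis_completion v) = v"
    using basis_completion[OF v v0] by auto
  then obtain vs where bv: "basis_completion v = v # vs"
    using n by (cases "basis_completion v") auto
  have ws: "set ws \<subseteq> carrier_vec n" "corthogonal ws" "length ws = n"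
    using gram_schmidt_result[OF b(1-3) refl] b(4) by (auto simp: ws_def)
  have ws0: "ws ! 0 = v"
    using gram_schmidt_hd[OF v, of vs] n ws(3) unfolding ws_def bv
    by (metis hd_conv_nth length_greater_0_conv)
  define W where "W = mat n n (\<lambda>(i, j). (ws ! j) $ i / sqrt ((ws ! j) \<bullet> (ws ! j)))"
  have W: "W \<in> carrier_mat n n" by (simp add: W_def)
  have wsc: "ws ! j \<in> carrier_vec n" if "j < n" for j using ws that by auto
  have pos: "(ws ! j) \<bullet> (ws ! j) > 0" if "j < n" for j
    using corthogonalD[OF ws(2), of j j] that ws(3) scalar_prod_self_nonneg[of "ws ! j"]
    by (simp add: conjugate_real_def order_less_le conjugate_vec_def)
  have cl: "col W j = (1 / sqrt ((ws ! j) \<bullet> (ws ! j))) \<cdot>\<^sub>v (ws ! j)" if "j < n" for j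
    using that wsc[OF that] by (intro eq_vecI) (auto simp: W_def)
  have "transpose_mat W * W = 1\<^sub>m n"
  proof (rule eq_matI)
    fix i j assume "i < dim_row (1\<^sub>m n :: real mat)" "j < dim_col (1\<^sub>m n :: real mat)"
    then have ij: "i < n" "j < n" by auto
    have "(transpose_mat W * W) $$ (i, j) = col W i \<bullet> col W j"
      using W ij by simp
    also have "\<dots> = ((ws ! i) \<bullet> (ws ! j)) / (sqrt ((ws ! i) \<bullet> (ws ! i)) * sqrt ((ws ! j) \<bullet> (ws ! j)))"
      using wsc[OF ij(1)] wsc[OF ij(2)] by (simp add: cl[OF ij(1)] cl[OF ij(2)])
    also have "\<dots> = (if i = j then 1 else 0)"
    proof (cases "i = j")
      case True
      then show ?thesis using pos[OF ij(1)] by simp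
    next
      case False
      then have "(ws ! i) \<bullet> (ws ! j) = 0"
        using corthogonalD[OF ws(2), of i j] ij ws(3) by simp
      then show ?thesis using False by simp
    qed
    finally show "(transpose_mat W * W) $$ (i, j) = 1\<^sub>m n $$ (i, j)" using ij by simp
  qed (use W in auto)
  with W cl[OF n] ws0 show thesis using that by metis
qed

lemma transpose_mat_mult_mult_symmetric:
  fixes A W :: "'a :: comm_semiring_0 mat"
  assumes A: "A \<in> carrier_mat n n" and sym: "transpose_mat A = A" and W: "W \<in> carrier_mat n k"
  shows "transpose_mat (transpose_mat W * A * W) = transpose_mat W * A * W"
proof -
  have "transpose_mat (transpose_mat W * A * W) = transpose_mat W * transpose_mat (transpose_mat W * A)"
    using A W by (intro transpose_mult) auto
  also have "transpose_mat (transpose_mat W * A) = A * W"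
    using A W sym by (subst transpose_mult[of _ k n]) auto
  finally show ?thesis using A W by (simp add: assoc_mult_mat[of _ k n])
qed

text \<open>Deflation: in an orthonormal basis that starts with an eigenvector the matrix splits
  into a 1 x 1 block and a symmetric n x n block, and the induction hypothesis diagonalises the
  latter.\<close>

theorem real_symmetric_spectral_decomposition:
  fixes A :: "real mat"
  assumes "A \<in> carrier_mat n n" "transpose_mat A = A"
  shows "\<exists>Q D. Q \<in> carrier_mat n n \<and> D \<in> carrier_mat n n \<and> transpose_mat Q * Q = 1\<^sub>m n \<and>
           diagonal_mat D \<and> A = Q * D * transpose_mat Q"
  using assms
proof (induction n arbitrary: A)
  case 0
  show ?case
    by (rule exI[of _ "1\<^sub>m 0"], rule exI[of _ "1\<^sub>m 0"])
       (use 0 in \<open>auto simp: diagonal_mat_def intro!: eq_matI\<close>)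
next
  case (Suc n A)
  note A = Suc.prems(1) and sym = Suc.prems(2)
  obtain e v where v: "v \<in> carrier_vec (Suc n)" "v \<noteq> 0\<^sub>v (Suc n)" "A *\<^sub>v v = e \<cdot>\<^sub>v v"
    using symmetric_real_eigenvector_exists[OF A sym] by blast
  obtain W c where W: "W \<in> carrier_mat (Suc n) (Suc n)" "transpose_mat W * W = 1\<^sub>m (Suc n)"
    and W0: "col W 0 = c \<cdot>\<^sub>v v"
    using orthogonal_mat_first_column[OF v(1,2)] by blast
  have W': "W * transpose_mat W = 1\<^sub>m (Suc n)"
    using mat_mult_left_right_inverse[of "transpose_mat W" "Suc n" W] W by simp
  define B where "B = transpose_mat W * A * W"
  have B: "B \<in> carrier_mat (Suc n) (Suc n)" using A W by (simp add: B_def)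
  have symB: "transpose_mat B = B"
    unfolding B_def by (rule transpose_mat_mult_mult_symmetric[OF A sym W(1)])
  \<comment> \<open>The first column of W is a multiple of the eigenvector, so the first column of B
    is e times the first unit vector. Symmetry of B then clears the first row as well.\<close>
  have B0: "B $$ (i, 0) = (if i = 0 then e else 0)" if i: "i < Suc n" for i
  proof -
    have "B $$ (i, 0) = col W i \<bullet> col (A * W) 0"
      using i A W unfolding B_def by (simp add: assoc_mult_mat[of _ "Suc n" "Suc n"])
    also have "col (A * W) 0 = A *\<^sub>v col W 0"
      using A W by (intro col_mult2) auto
    also have "\<dots> = e \<cdot>\<^sub>v col W 0"
      unfolding W0 using A v by (auto simp: smult_smult_assoc mult_mat_vec[OF A] mult.commute)
    also have "col W i \<bullet> (e \<cdot>\<^sub>v col W 0) = e * (transpose_mat W * W) $$ (i, 0)"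
      using i W(1) by simp
    finally show ?thesis unfolding W(2) using i by simp
  qed
  define A3 where "A3 = mat n n (\<lambda>(i, j). B $$ (Suc i, Suc j))"
  have A3: "A3 \<in> carrier_mat n n" by (simp add: A3_def)
  have Bsym: "B $$ (i, j) = B $$ (j, i)" if "i < Suc n" "j < Suc n" for i j
    using arg_cong[OF symB, of "\<lambda>M. M $$ (i, j)"] that B by simp
  have symA3: "transpose_mat A3 = A3"
    by (rule eq_matI) (auto simp: A3_def intro: Bsym)
  define E where "E = mat 1 1 (\<lambda>_. e)"
  have E: "E \<in> carrier_mat 1 1" by (simp add: E_def)
  have Bblock: "B = four_block_mat E (0\<^sub>m 1 n) (0\<^sub>m n 1) A3"
    by (rule eq_matI)
       (use B B0 Bsym[of 0] in \<open>auto simp: A3_def E_def\<close>)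
  obtain Q3 D3 where Q3: "Q3 \<in> carrier_mat n n" "D3 \<in> carrier_mat n n"
    "transpose_mat Q3 * Q3 = 1\<^sub>m n" "diagonal_mat D3" "A3 = Q3 * D3 * transpose_mat Q3"
    using Suc.IH[OF A3 symA3] by blast
  define R where "R = four_block_mat (1\<^sub>m 1) (0\<^sub>m 1 n) (0\<^sub>m n 1) Q3"
  define D where "D = four_block_mat E (0\<^sub>m 1 n) (0\<^sub>m n 1) D3"
  have R: "R \<in> carrier_mat (Suc n) (Suc n)" and D: "D \<in> carrier_mat (Suc n) (Suc n)"
    using Q3 E four_block_carrier_mat[of "1\<^sub>m 1" 1 1 Q3 n n] four_block_carrier_mat[of E 1 1 D3 n n]
    by (auto simp: R_def D_def)
  have Rt: "transpose_mat R = four_block_mat (1\<^sub>m 1) (0\<^sub>m 1 n) (0\<^sub>m n 1) (transpose_mat Q3)"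
    unfolding R_def by (subst transpose_four_block_mat[of _ 1 1 _ n _ n]) (use Q3 in auto)
  have RR: "transpose_mat R * R = 1\<^sub>m (Suc n)"
    unfolding Rt unfolding R_def
    by (subst mult_four_block_mat[of _ 1 1 _ n _ n _ _ 1 _ n])
       (use Q3 in \<open>auto intro!: eq_matI\<close>)
  have diag: "diagonal_mat D"
    using Q3(2,4) E unfolding diagonal_mat_def D_def
    by (auto simp: less_Suc_eq_0_disj) blast
  have BD: "B = R * D * transpose_mat R"
  proof -
    have "R * D = four_block_mat E (0\<^sub>m 1 n) (0\<^sub>m n 1) (Q3 * D3)"
      unfolding R_def D_def
      by (subst mult_four_block_mat[of _ 1 1 _ n _ n _ _ 1 _ n]) (use Q3 E in auto)
    then show ?thesis
      unfolding Rt Bblock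
      by (simp only:, subst mult_four_block_mat[of _ 1 1 _ n _ n _ _ 1 _ n]) (use Q3 E in auto)
  qed
  define Q where "Q = W * R"
  have Q: "Q \<in> carrier_mat (Suc n) (Suc n)" using W R by (simp add: Q_def)
  have Qt: "transpose_mat Q = transpose_mat R * transpose_mat W"
    unfolding Q_def using W R by (intro transpose_mult) auto
  note [simp] = assoc_mult_mat[of _ "Suc n" "Suc n" _ "Suc n" _ "Suc n"]
    mult_carrier_mat[of _ "Suc n" "Suc n" _ "Suc n"]
  have "transpose_mat Q * Q = transpose_mat R * ((transpose_mat W * W) * R)"
    unfolding Qt unfolding Q_def using W(1) R by simp
  also have "\<dots> = 1\<^sub>m (Suc n)"
    unfolding W(2) using RR R by simp
  finally have QQ: "transpose_mat Q * Q = 1\<^sub>m (Suc n)" .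
  have "Q * D * transpose_mat Q = W * B * transpose_mat W"
    unfolding BD Qt unfolding Q_def using W(1) R D by simp
  also have "\<dots> = (W * transpose_mat W) * A * (W * transpose_mat W)"
    unfolding B_def using W(1) A by simp
  also have "\<dots> = A"
    unfolding W' using A by simp
  finally show ?case
    using Q D QQ diag by metis
qed

section \<open>Inverse square roots of positive definite matrices\<close>

text \<open>Functional calculus in a fixed eigenbasis: if Q diagonalises G with eigenvalues d, then
  f(G) is \<open>diag_conj Q (\<lambda>l. f (d l))\<close>, and matrix products become pointwise
  products.\<close>

definition diag_conj :: "real mat \<Rightarrow> (nat \<Rightarrow> real) \<Rightarrow> real mat" where
  "diag_conj Q f = Q * mat_diag (dim_row Q) f * transpose_mat Q"

context
  fixes Q :: "real mat" and k :: nat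
  assumes Q: "Q \<in> carrier_mat k k" and QQ: "transpose_mat Q * Q = 1\<^sub>m k"
begin

lemma mult_transpose_orthogonal: "Q * transpose_mat Q = 1\<^sub>m k"
  using mat_mult_left_right_inverse[of "transpose_mat Q" k Q] Q QQ by simp

lemma diag_conj_carrier: "diag_conj Q f \<in> carrier_mat k k"
  using Q by (simp add: diag_conj_def mult_carrier_mat[of _ k k _ k])

lemma diag_conj_one: "diag_conj Q (\<lambda>_. 1) = 1\<^sub>m k"
  using Q mult_transpose_orthogonal by (simp add: diag_conj_def)

lemma diag_conj_mult: "diag_conj Q f * diag_conj Q g = diag_conj Q (\<lambda>l. f l * g l)"
proof -
  note [simp] = assoc_mult_mat[of _ k k _ k _ k] mult_carrier_mat[of _ k k _ k]
  have "diag_conj Q f * diag_conj Q g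
      = Q * (mat_diag k f * ((transpose_mat Q * Q) * (mat_diag k g * transpose_mat Q)))"
    using Q by (simp add: diag_conj_def)
  also have "\<dots> = Q * (mat_diag k f * mat_diag k g) * transpose_mat Q"
    unfolding QQ using Q by (simp del: mat_diag_diag add: left_mult_one_mat[of _ k k])
  finally show ?thesis using Q by (simp add: diag_conj_def)
qed

lemma transpose_diag_conj: "transpose_mat (diag_conj Q f) = diag_conj Q f"
proof -
  have "transpose_mat (mat_diag k f) = mat_diag k f"
    by (rule eq_matI) (auto simp: mat_diag_def)
  then show ?thesis
    using transpose_mat_mult_mult_symmetric[of "mat_diag k f" k "transpose_mat Q" k] Q
    by (simp add: diag_conj_def)
qed

lemma diag_conj_index:
  assumes "i < k" "j < k"
  shows "diag_conj Q f $$ (i, j) = (\<Sum>l<k. f l * (Q $$ (i, l) * Q $$ (j, l)))"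
proof -
  have "diag_conj Q f $$ (i, j) = row (Q * mat_diag k f) i \<bullet> row Q j"
    using Q assms by (simp add: diag_conj_def)
  also have "Q * mat_diag k f = mat k k (\<lambda>(i, j). f j * Q $$ (i, j))"
    using Q by (subst mat_diag_mult_right) auto
  finally show ?thesis
    using Q assms by (simp add: scalar_prod_def atLeast0LessThan mult_ac)
qed

lemma scalar_prod_diag_conj:
  assumes v: "v \<in> carrier_vec k"
  shows "v \<bullet> (diag_conj Q f *\<^sub>v v) = (\<Sum>l<k. f l * ((transpose_mat Q *\<^sub>v v) $ l)\<^sup>2)"
proof -
  let ?w = "transpose_mat Q *\<^sub>v v"
  have w: "?w \<in> carrier_vec k" using Q v by simp
  have "diag_conj Q f *\<^sub>v v = Q *\<^sub>v (mat_diag k f *\<^sub>v ?w)"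
    using Q v by (simp add: diag_conj_def assoc_mult_mat_vec[of _ k k _ k])
  then have "v \<bullet> (diag_conj Q f *\<^sub>v v) = ?w \<bullet> (mat_diag k f *\<^sub>v ?w)"
    using transpose_vec_mult_scalar[of Q k k "mat_diag k f *\<^sub>v ?w" v] Q v w
    by (simp add: mult_mat_vec_carrier[of _ k k])
  also have "mat_diag k f *\<^sub>v ?w = vec k (\<lambda>l. f l * ?w $ l)"
  proof (rule eq_vecI)
    fix i assume "i < dim_vec (vec k (\<lambda>l. f l * ?w $ l))"
    then have i: "i < k" by simp
    have "(mat_diag k f *\<^sub>v ?w) $ i = (\<Sum>l = 0..<k. (if i = l then f l else 0) * ?w $ l)"
      using i w Q by (simp add: scalar_prod_def mat_diag_def)
    also have "\<dots> = (\<Sum>l = 0..<k. if i = l then f l * ?w $ l else 0)"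
      by (intro sum.cong) auto
    also have "\<dots> = f i * ?w $ i" using i by simp
    finally show "(mat_diag k f *\<^sub>v ?w) $ i = vec k (\<lambda>l. f l * ?w $ l) $ i" using i by simp
  qed (simp add: mat_diag_def)
  finally show ?thesis
    using w by (simp add: scalar_prod_def atLeast0LessThan power2_eq_square mult_ac)
qed

lemma trace_diag_conj: "(\<Sum>i<k. diag_conj Q f $$ (i, i)) = (\<Sum>l<k. f l)"
proof -
  have "(\<Sum>i<k. diag_conj Q f $$ (i, i)) = (\<Sum>i<k. \<Sum>l<k. f l * (Q $$ (i, l) * Q $$ (i, l)))"
    by (simp add: diag_conj_index)
  also have "\<dots> = (\<Sum>l<k. f l * (\<Sum>i<k. Q $$ (i, l) * Q $$ (i, l)))"
    by (subst sum.swap) (simp add: sum_distrib_left)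
  also have "\<dots> = (\<Sum>l<k. f l)"
  proof (rule sum.cong)
    fix l assume "l \<in> {..<k}"
    then have l: "l < k" by simp
    have "(transpose_mat Q * Q) $$ (l, l) = (\<Sum>i<k. Q $$ (i, l) * Q $$ (i, l))"
      using l Q by (simp add: scalar_prod_def atLeast0LessThan)
    then show "f l * (\<Sum>i<k. Q $$ (i, l) * Q $$ (i, l)) = f l" using l QQ by simp
  qed simp
  finally show ?thesis .
qed

lemma diag_conj_cong: "(\<And>l. l < k \<Longrightarrow> f l = g l) \<Longrightarrow> diag_conj Q f = diag_conj Q g"
  using Q by (simp add: diag_conj_def mat_diag_def cong: if_cong) (intro arg_cong[of _ _ "\<lambda>M. Q * M * transpose_mat Q"] eq_matI; auto)

end

text \<open>The spectral theorem guarantees a witness for the \<open>SOME\<close> in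
  \<open>inv_sqrt_mat\<close>. Once it is unpacked, statements about G and its inverse square root
  reduce to statements about the numbers d l in one common eigenbasis.\<close>

lemma inv_sqrt_mat_diag_conj:
  assumes pd: "posdef_mat G" and G: "G \<in> carrier_mat k k"
  obtains Q d where "Q \<in> carrier_mat k k" "transpose_mat Q * Q = 1\<^sub>m k" "\<And>l. l < k \<Longrightarrow> d l > 0"
    "G = diag_conj Q d" "inv_sqrt_mat G = diag_conj Q (\<lambda>l. 1 / sqrt (d l))"
proof -
  let ?P = "\<lambda>M. \<exists>Q D. Q \<in> carrier_mat (dim_row G) (dim_row G) \<and>
                   D \<in> carrier_mat (dim_row G) (dim_row G) \<and>
                   transpose_mat Q * Q = 1\<^sub>m (dim_row G) \<and> diagonal_mat D \<and>
                   G = Q * D * transpose_mat Q \<and>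
                   M = Q * mat (dim_row G) (dim_row G)
                         (\<lambda>(i,j). if i = j then 1 / sqrt (D $$ (i,i)) else 0) * transpose_mat Q"
  have sym: "transpose_mat G = G"
    and pos: "\<And>v. v \<in> carrier_vec k \<Longrightarrow> v \<noteq> 0\<^sub>v k \<Longrightarrow> v \<bullet> (G *\<^sub>v v) > 0"
    using pd G unfolding posdef_mat_def by auto
  have "\<exists>M. ?P M"
    using real_symmetric_spectral_decomposition[OF G sym] G by auto
  then have "?P (SOME M. ?P M)" by (rule someI_ex)
  then have "?P (inv_sqrt_mat G)" using pd by (simp add: inv_sqrt_mat_def)
  then obtain Q D where Q: "Q \<in> carrier_mat k k" "transpose_mat Q * Q = 1\<^sub>m k"
    and D: "D \<in> carrier_mat k k" "diagonal_mat D" and GQ: "G = Q * D * transpose_mat Q"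
    and I: "inv_sqrt_mat G = Q * mat k k (\<lambda>(i,j). if i = j then 1 / sqrt (D $$ (i,i)) else 0) * transpose_mat Q"
    using G by auto
  define d where "d l = D $$ (l, l)" for l
  have "D = mat_diag k d"
    using D by (intro eq_matI) (auto simp: mat_diag_def d_def diagonal_mat_def)
  then have Gd: "G = diag_conj Q d" using GQ Q by (simp add: diag_conj_def)
  have "mat k k (\<lambda>(i,j). if i = j then 1 / sqrt (D $$ (i,i)) else 0) = mat_diag k (\<lambda>l. 1 / sqrt (d l))"
    by (rule eq_matI) (auto simp: mat_diag_def d_def)
  then have Id: "inv_sqrt_mat G = diag_conj Q (\<lambda>l. 1 / sqrt (d l))"
    using I Q by (simp add: diag_conj_def)
  \<comment> \<open>Testing positive definiteness at the l-th column of Q returns exactly the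
    eigenvalue d l.\<close>
  have "d l > 0" if l: "l < k" for l
  proof -
    have Qc: "col Q l \<in> carrier_vec k" using Q(1) by auto
    have e: "transpose_mat Q *\<^sub>v col Q l = unit_vec k l"
    proof (rule eq_vecI)
      fix i assume "i < dim_vec (unit_vec k l :: real vec)"
      then have i: "i < k" by simp
      have "(transpose_mat Q *\<^sub>v col Q l) $ i = (transpose_mat Q * Q) $$ (i, l)"
        using i l Q(1) by simp
      then show "(transpose_mat Q *\<^sub>v col Q l) $ i = unit_vec k l $ i"
        using i l Q(2) by (auto simp: unit_vec_def)
    qed (use Q in simp)
    have "col Q l \<noteq> 0\<^sub>v k"
    proof
      assume "col Q l = 0\<^sub>v k"
      moreover have "transpose_mat Q *\<^sub>v 0\<^sub>v k = 0\<^sub>v k"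
        using Q(1) by (intro eq_vecI) auto
      ultimately have "unit_vec k l = (0\<^sub>v k :: real vec)"
        using e by simp
      then show False using l by (metis index_unit_vec(2) index_zero_vec(1) zero_neq_one)
    qed
    then have "0 < col Q l \<bullet> (diag_conj Q d *\<^sub>v col Q l)"
      using pos[OF Qc] Gd by simp
    also have "\<dots> = (\<Sum>i<k. d i * (unit_vec k l $ i)\<^sup>2)"
      by (simp only: scalar_prod_diag_conj[OF Q Qc] e)
    also have "\<dots> = (\<Sum>i<k. if i = l then d i else 0)"
      using l by (intro sum.cong) (auto simp: unit_vec_def)
    also have "\<dots> = d l" using l by simp
    finally show ?thesis .
  qed
  then show thesis using that Q Gd Id by blast
qed

text \<open>The product \<open>inv_sqrt_mat G * G\<close> plays the role of G^(1/2): its eigenvalues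
  are d / sqrt d = sqrt d, hence its square is G and its quadratic form is nonnegative.\<close>

lemma inv_sqrt_mat_props:
  assumes pd: "posdef_mat G" and G: "G \<in> carrier_mat k k"
  shows "inv_sqrt_mat G \<in> carrier_mat k k"
    "transpose_mat (inv_sqrt_mat G) = inv_sqrt_mat G"
    "inv_sqrt_mat G * G * inv_sqrt_mat G = 1\<^sub>m k"
    "(inv_sqrt_mat G * G) * (inv_sqrt_mat G * G) = G"
    "v \<in> carrier_vec k \<Longrightarrow> v \<bullet> ((inv_sqrt_mat G * G) *\<^sub>v v) \<ge> 0"
proof -
  obtain Q d where Q: "Q \<in> carrier_mat k k" "transpose_mat Q * Q = 1\<^sub>m k"
    and d: "\<And>l. l < k \<Longrightarrow> d l > 0" and GW: "G = diag_conj Q d"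
    "inv_sqrt_mat G = diag_conj Q (\<lambda>l. 1 / sqrt (d l))"
    using inv_sqrt_mat_diag_conj[OF pd G] by blast
  show "inv_sqrt_mat G \<in> carrier_mat k k" "transpose_mat (inv_sqrt_mat G) = inv_sqrt_mat G"
    unfolding GW(2) by (rule diag_conj_carrier[OF Q] transpose_diag_conj[OF Q])+
  have S: "inv_sqrt_mat G * G = diag_conj Q (\<lambda>l. sqrt (d l))"
    unfolding GW(2) unfolding GW(1) unfolding diag_conj_mult[OF Q]
    using d by (intro diag_conj_cong[OF Q]) (simp add: real_div_sqrt less_imp_le)
  show "inv_sqrt_mat G * G * inv_sqrt_mat G = 1\<^sub>m k"
    unfolding S unfolding GW(2) diag_conj_mult[OF Q] diag_conj_one[OF Q, symmetric]
    using d by (intro diag_conj_cong[OF Q]) (metis less_irrefl nonzero_mult_div_cancel_left real_sqrt_eq_zero_cancel_iff times_divide_eq_right mult.right_neutral)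
  show "(inv_sqrt_mat G * G) * (inv_sqrt_mat G * G) = G"
    unfolding S diag_conj_mult[OF Q] unfolding GW(1)
    using d by (intro diag_conj_cong[OF Q]) (simp add: less_imp_le)
  show "v \<in> carrier_vec k \<Longrightarrow> v \<bullet> ((inv_sqrt_mat G * G) *\<^sub>v v) \<ge> 0"
    unfolding S using d
    by (auto simp: scalar_prod_diag_conj[OF Q] less_imp_le intro!: sum_nonneg mult_nonneg_nonneg)
qed

text \<open>Powers of G / tr G - I. For positive definite G the trace is at least every eigenvalue,
  so the eigenvalues of this matrix lie in (-1, 0], where the binomial series of (1 + x)^(-1/2)
  converges. Unlike the largest eigenvalue, the trace is a plain sum of entries.\<close>

fun centered_pow :: "nat \<Rightarrow> real mat \<Rightarrow> nat \<Rightarrow> real mat" where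
  "centered_pow k G 0 = 1\<^sub>m k"
| "centered_pow k G (Suc m) = centered_pow k G m *
     mat k k (\<lambda>(i, j). G $$ (i, j) / (\<Sum>l<k. G $$ (l, l)) - (if i = j then 1 else 0))"

text \<open>This series determines the inverse square root entrywise from the entries of \<open>G\<close>, so
  that it is a measurable function of them although it is defined by a choice of eigenbasis.\<close>

lemma inv_sqrt_mat_index_sums:
  assumes pd: "posdef_mat G" and G: "G \<in> carrier_mat k k" and ij: "i < k" "j < k"
  shows "(\<lambda>m. (-1/2 gchoose m) * centered_pow k G m $$ (i, j) / sqrt (\<Sum>l<k. G $$ (l, l)))
    sums (inv_sqrt_mat G $$ (i, j))"
proof -
  obtain Q d where Q: "Q \<in> carrier_mat k k" "transpose_mat Q * Q = 1\<^sub>m k"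
    and d: "\<And>l. l < k \<Longrightarrow> d l > 0" and GW: "G = diag_conj Q d"
    "inv_sqrt_mat G = diag_conj Q (\<lambda>l. 1 / sqrt (d l))"
    using inv_sqrt_mat_diag_conj[OF pd G] by blast
  define c where "c = (\<Sum>l<k. d l)"
  have tr: "(\<Sum>l<k. G $$ (l, l)) = c"
    unfolding GW(1) c_def by (rule trace_diag_conj[OF Q])
  have dc: "d l \<le> c" if "l < k" for l
    unfolding c_def using that d by (intro member_le_sum) (auto intro: less_imp_le)
  have c: "c > 0" using d dc ij(1) by fastforce
  have step: "mat k k (\<lambda>(i, j). G $$ (i, j) / (\<Sum>l<k. G $$ (l, l)) - (if i = j then 1 else 0))
      = diag_conj Q (\<lambda>l. d l / c - 1)"
  proof (rule eq_matI)
    fix i j assume "i < dim_row (diag_conj Q (\<lambda>l. d l / c - 1))" "j < dim_col (diag_conj Q (\<lambda>l. d l / c - 1))"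
    then have ij: "i < k" "j < k" using Q by (auto simp: diag_conj_def)
    have "(if i = j then 1 else 0) = diag_conj Q (\<lambda>_. 1) $$ (i, j)"
      using ij by (simp add: diag_conj_one[OF Q])
    then show "mat k k (\<lambda>(i, j). G $$ (i, j) / (\<Sum>l<k. G $$ (l, l)) - (if i = j then 1 else 0)) $$ (i, j)
      = diag_conj Q (\<lambda>l. d l / c - 1) $$ (i, j)"
      using ij unfolding tr
      by (simp add: GW(1) diag_conj_index[OF Q] sum_divide_distrib sum_subtractf[symmetric] algebra_simps)
  qed (use Q in \<open>auto simp: diag_conj_def\<close>)
  have pow: "centered_pow k G m = diag_conj Q (\<lambda>l. (d l / c - 1) ^ m)" for m
  proof (induction m)
    case 0
    show ?case by (simp add: diag_conj_one[OF Q])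
  next
    case (Suc m)
    show ?case
      unfolding centered_pow.simps step Suc diag_conj_mult[OF Q] by (simp add: mult.commute)
  qed
  have "(\<lambda>m. (-1/2 gchoose m) * (d l / c - 1) ^ m / sqrt c * (Q $$ (i, l) * Q $$ (j, l)))
      sums (1 / sqrt (d l) * (Q $$ (i, l) * Q $$ (j, l)))" if l: "l < k" for l
  proof -
    have "\<bar>d l / c - 1\<bar> < 1"
      using d[OF l] dc[OF l] c by (auto simp: abs_if field_simps)
    then have "(\<lambda>m. (-1/2 gchoose m) * (d l / c - 1) ^ m) sums ((1 + (d l / c - 1)) powr (-1/2))"
      by (rule gen_binomial_real)
    \<comment> \<open>The series is evaluated at d l / c; the additional division by sqrt c in the
      summands undoes the scaling by the trace c.\<close>
    moreover have "(1 + (d l / c - 1)) powr (-1/2) = sqrt c / sqrt (d l)"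
      using d[OF l] c by (simp add: powr_minus powr_half_sqrt real_sqrt_divide inverse_eq_divide)
    ultimately have "(\<lambda>m. (-1/2 gchoose m) * (d l / c - 1) ^ m / sqrt c * (Q $$ (i, l) * Q $$ (j, l)))
      sums (sqrt c / sqrt (d l) / sqrt c * (Q $$ (i, l) * Q $$ (j, l)))"
      by (intro sums_mult2 sums_divide) simp
    then show ?thesis using c by simp
  qed
  then have "(\<lambda>m. \<Sum>l<k. (-1/2 gchoose m) * (d l / c - 1) ^ m / sqrt c * (Q $$ (i, l) * Q $$ (j, l)))
      sums (\<Sum>l<k. 1 / sqrt (d l) * (Q $$ (i, l) * Q $$ (j, l)))"
    by (intro sums_sum) auto
  then show ?thesis
    unfolding tr GW(2) pow diag_conj_index[OF Q ij]
    by (simp add: sum_distrib_left sum_divide_distrib mult_ac)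
qed

section \<open>The whitening matrix of a design\<close>

lemma gram_mat_carrier: "X \<in> carrier_mat n p \<Longrightarrow> transpose_mat X * X \<in> carrier_mat p p"
  by auto

lemma transpose_gram_mat:
  fixes X :: "real mat"
  assumes "X \<in> carrier_mat n p"
  shows "transpose_mat (transpose_mat X * X) = transpose_mat X * X"
  using assms by (subst transpose_mult[of _ p n]) auto

lemma scalar_prod_gram_mat:
  fixes X :: "real mat"
  assumes X: "X \<in> carrier_mat n p" and v: "v \<in> carrier_vec p"
  shows "v \<bullet> ((transpose_mat X * X) *\<^sub>v v) = (X *\<^sub>v v) \<bullet> (X *\<^sub>v v)"
proof -
  have "(transpose_mat X * X) *\<^sub>v v = transpose_mat X *\<^sub>v (X *\<^sub>v v)"
    using X v by (intro assoc_mult_mat_vec) auto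
  then show ?thesis
    using transpose_vec_mult_scalar[of "transpose_mat X" p n "X *\<^sub>v v" v] X v by simp
qed

text \<open>A Gram matrix satisfies v . G v = |X v|^2, so it is positive definite as soon as its
  kernel is trivial. The determinant is a polynomial in the entries, which makes positive
  definiteness a measurable event.\<close>

lemma posdef_gram_mat_iff_det:
  fixes X :: "real mat"
  assumes X: "X \<in> carrier_mat n p"
  shows "posdef_mat (transpose_mat X * X) \<longleftrightarrow> Determinant.det (transpose_mat X * X) \<noteq> 0"
proof -
  note G = gram_mat_carrier[OF X]
  have "posdef_mat (transpose_mat X * X) \<longleftrightarrow>
      (\<forall>v\<in>carrier_vec p. v \<noteq> 0\<^sub>v p \<longrightarrow> v \<bullet> ((transpose_mat X * X) *\<^sub>v v) > 0)"
    using G transpose_gram_mat[OF X] unfolding posdef_mat_def by auto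
  also have "\<dots> \<longleftrightarrow> (\<forall>v\<in>carrier_vec p. v \<noteq> 0\<^sub>v p \<longrightarrow> (transpose_mat X * X) *\<^sub>v v \<noteq> 0\<^sub>v p)"
  proof (intro ball_cong refl imp_cong iffI notI)
    fix v :: "real vec" assume v: "v \<in> carrier_vec p"
    { assume "v \<bullet> ((transpose_mat X * X) *\<^sub>v v) > 0" "(transpose_mat X * X) *\<^sub>v v = 0\<^sub>v p"
      then show False using v by simp }
    { assume "(transpose_mat X * X) *\<^sub>v v \<noteq> 0\<^sub>v p"
      moreover have "(transpose_mat X * X) *\<^sub>v v = transpose_mat X *\<^sub>v (X *\<^sub>v v)"
        using X v by (intro assoc_mult_mat_vec) auto
      moreover have "transpose_mat X *\<^sub>v 0\<^sub>v n = 0\<^sub>v p"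
        using X by (intro eq_vecI) auto
      ultimately have "X *\<^sub>v v \<noteq> 0\<^sub>v n" by auto
      then show "v \<bullet> ((transpose_mat X * X) *\<^sub>v v) > 0"
        unfolding scalar_prod_gram_mat[OF X v] using X v
        by (intro scalar_prod_self_pos[of _ n]) auto }
  qed
  also have "\<dots> \<longleftrightarrow> Determinant.det (transpose_mat X * X) \<noteq> 0"
    unfolding det_0_iff_vec_prod_zero[OF G] by auto
  finally show ?thesis .
qed

text \<open>The matrix G^(-1/2) X^T that maps y to z. For positive definite G its rows are
  orthonormal, and its product with X is G^(1/2); so it separates z into a signal part and a noise
  part.\<close>

definition whitener :: "real mat \<Rightarrow> real mat" where
  "whitener X = inv_sqrt_mat (transpose_mat X * X) * transpose_mat X"

lemma inv_sqrt_mat_carrier: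
  assumes G: "G \<in> carrier_mat k k"
  shows "inv_sqrt_mat G \<in> carrier_mat k k"
  using inv_sqrt_mat_props(1)[OF _ G] G by (cases "posdef_mat G") (auto simp: inv_sqrt_mat_def)

lemma whitener_carrier: "X \<in> carrier_mat n p \<Longrightarrow> whitener X \<in> carrier_mat p n"
  unfolding whitener_def
  by (rule mult_carrier_mat[of _ p p _ n]) (auto intro!: inv_sqrt_mat_carrier)

lemma z_stat_whitener:
  assumes X: "X \<in> carrier_mat n p" and y: "y \<in> carrier_vec n"
  shows "z_stat X y = whitener X *\<^sub>v y"
  unfolding z_stat_def whitener_def
  using assoc_mult_mat_vec[OF inv_sqrt_mat_carrier[OF gram_mat_carrier[OF X]], of "transpose_mat X" n y] X y
  by simp

context
  fixes X :: "real mat" and n p :: nat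
  assumes X: "X \<in> carrier_mat n p" and pd: "posdef_mat (transpose_mat X * X)"
begin

lemma whitener_mult_transpose: "whitener X * transpose_mat (whitener X) = 1\<^sub>m p"
proof -
  let ?G = "transpose_mat X * X"
  let ?W = "inv_sqrt_mat ?G"
  note G = gram_mat_carrier[OF X]
  note W = inv_sqrt_mat_props[OF pd G]
  have "transpose_mat (whitener X) = X * ?W"
    unfolding whitener_def using W(1,2) X by (subst transpose_mult[of _ p p]) auto
  then have "whitener X * transpose_mat (whitener X) = ?W * transpose_mat X * (X * ?W)"
    by (simp add: whitener_def)
  also have "\<dots> = ?W * (transpose_mat X * (X * ?W))"
    using W(1) X by (intro assoc_mult_mat[of _ p p _ n _ p]) auto
  also have "transpose_mat X * (X * ?W) = ?G * ?W"
    using W(1) X by (intro assoc_mult_mat[symmetric, of _ p n _ p _ p]) auto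
  also have "?W * (?G * ?W) = ?W * ?G * ?W"
    using W(1) G by (intro assoc_mult_mat[symmetric, of _ p p _ p _ p]) auto
  finally show ?thesis using W(3) by simp
qed

text \<open>The diagonal of V V^T = I for the whitener V. Unit rows are what makes each noise
  coordinate standard normal.\<close>

lemma sum_squares_whitener:
  assumes j: "j < p"
  shows "(\<Sum>i<n. (whitener X $$ (j, i))\<^sup>2) = 1"
proof -
  note V = whitener_carrier[OF X]
  have "(whitener X * transpose_mat (whitener X)) $$ (j, j) = 1"
    unfolding whitener_mult_transpose using j by simp
  then show ?thesis
    using V j by (simp add: scalar_prod_def atLeast0LessThan power2_eq_square)
qed

lemma whitener_mult: "whitener X * X = inv_sqrt_mat (transpose_mat X * X) * (transpose_mat X * X)"
  unfolding whitener_def using inv_sqrt_mat_props(1)[OF pd gram_mat_carrier[OF X]] X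
  by (intro assoc_mult_mat[of _ p p _ n _ p]) auto

text \<open>The inequality G^(1/2) + c I >= c I in a form without inverses; it is applied with c =
  sqrt n. Put S = G^(1/2), v = S b - c b and w = S v. Then w + c v = (G - c^2 I) b, and the cross
  term 2 c (v . w) in its squared length is nonnegative because S is positive semidefinite.\<close>

lemma whitener_mult_near_scalar:
  assumes b: "b \<in> carrier_vec p" and j: "j < p" and c: "c > 0"
  shows "c * \<bar>((whitener X * X) *\<^sub>v b) $ j - c * b $ j\<bar>
     \<le> sqrt (\<Sum>i<p. (((transpose_mat X * X) *\<^sub>v b) $ i - c\<^sup>2 * b $ i)\<^sup>2)"
proof -
  define G where "G = transpose_mat X * X"
  define S where "S = whitener X * X"
  have G: "G \<in> carrier_mat p p" using gram_mat_carrier[OF X] by (simp add: G_def)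
  have Sdef: "S = inv_sqrt_mat G * G" using whitener_mult by (simp add: S_def G_def)
  have S: "S \<in> carrier_mat p p" using whitener_carrier[OF X] X unfolding S_def by auto
  have SS: "S * S = G" and Spos: "\<And>v. v \<in> carrier_vec p \<Longrightarrow> v \<bullet> (S *\<^sub>v v) \<ge> 0"
    using inv_sqrt_mat_props(4,5)[OF pd gram_mat_carrier[OF X]]
    unfolding Sdef by (auto simp: G_def)
  define v where "v = S *\<^sub>v b - c \<cdot>\<^sub>v b"
  have v: "v \<in> carrier_vec p" using S b by (auto simp: v_def)
  define w where "w = S *\<^sub>v v"
  have w: "w \<in> carrier_vec p" using S v by (auto simp: w_def)
  have w_eq: "w = G *\<^sub>v b - c \<cdot>\<^sub>v (S *\<^sub>v b)"
  proof -
    have "w = S *\<^sub>v (S *\<^sub>v b) - S *\<^sub>v (c \<cdot>\<^sub>v b)"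
      unfolding w_def v_def using S b by (intro mult_minus_distrib_mat_vec) auto
    then show ?thesis
      using S b by (simp add: SS[symmetric] assoc_mult_mat_vec[of _ p p _ p] mult_mat_vec[of S p p])
  qed
  have "(c * \<bar>v $ j\<bar>)\<^sup>2 \<le> (\<Sum>i<p. c\<^sup>2 * (v $ i)\<^sup>2)"
    using j member_le_sum[of j "{..<p}" "\<lambda>i. c\<^sup>2 * (v $ i)\<^sup>2"] by (simp add: power_mult_distrib)
  also have "\<dots> \<le> (\<Sum>i<p. c\<^sup>2 * (v $ i)\<^sup>2) + (\<Sum>i<p. (w $ i)\<^sup>2) + 2 * c * (v \<bullet> w)"
    using Spos[OF v] c by (simp add: sum_nonneg w_def[symmetric])
  also have "\<dots> = (\<Sum>i<p. (w $ i + c * v $ i)\<^sup>2)"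
  proof -
    have "(w $ i + c * v $ i)\<^sup>2 = c\<^sup>2 * (v $ i)\<^sup>2 + (w $ i)\<^sup>2 + 2 * c * (v $ i * w $ i)" for i
      by (simp add: power2_eq_square algebra_simps)
    moreover have "v \<bullet> w = (\<Sum>i<p. v $ i * w $ i)"
      using v w by (simp add: scalar_prod_def atLeast0LessThan)
    ultimately show ?thesis by (simp only: sum.distrib sum_distrib_left)
  qed
  also have "\<dots> = (\<Sum>i<p. ((G *\<^sub>v b) $ i - c\<^sup>2 * b $ i)\<^sup>2)"
  proof (rule sum.cong)
    fix i assume "i \<in> {..<p}"
    then have i: "i < p" by simp
    have wi: "w $ i = (G *\<^sub>v b) $ i - c * (S *\<^sub>v b) $ i"
      unfolding w_eq using i S G b by simp
    have vi: "v $ i = (S *\<^sub>v b) $ i - c * b $ i"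
      unfolding v_def using i S b by simp
    have "w $ i + c * v $ i = (G *\<^sub>v b) $ i - c\<^sup>2 * b $ i"
      unfolding wi vi by (simp add: algebra_simps power2_eq_square)
    then show "(w $ i + c * v $ i)\<^sup>2 = ((G *\<^sub>v b) $ i - c\<^sup>2 * b $ i)\<^sup>2" by simp
  qed simp
  finally have "c * \<bar>v $ j\<bar> \<le> sqrt (\<Sum>i<p. ((G *\<^sub>v b) $ i - c\<^sup>2 * b $ i)\<^sup>2)"
    by (rule real_le_rsqrt)
  moreover have "v $ j = (S *\<^sub>v b) $ j - c * b $ j"
    unfolding v_def using j S b by simp
  ultimately show ?thesis by (simp add: G_def S_def)
qed

end

section \<open>Measurability of the inverse square root\<close>

text \<open>Measurability is required entry by entry, together with fixed dimensions, since the type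
  of matrices does not determine them.\<close>

definition measurable_mat :: "'w measure \<Rightarrow> nat \<Rightarrow> nat \<Rightarrow> ('w \<Rightarrow> real mat) \<Rightarrow> bool" where
  "measurable_mat M n p X \<longleftrightarrow> (\<forall>\<omega>\<in>space M. X \<omega> \<in> carrier_mat n p) \<and>
     (\<forall>i<n. \<forall>j<p. (\<lambda>\<omega>. X \<omega> $$ (i, j)) \<in> borel_measurable M)"

lemma measurable_mat_mult:
  assumes X: "measurable_mat M n m X" and Y: "measurable_mat M m p Y"
  shows "measurable_mat M n p (\<lambda>\<omega>. X \<omega> * Y \<omega>)"
  unfolding measurable_mat_def
proof (intro conjI ballI allI impI)
  fix i j assume ij: "i < n" "j < p"
  have "(\<lambda>\<omega>. \<Sum>l<m. X \<omega> $$ (i, l) * Y \<omega> $$ (l, j)) \<in> borel_measurable M"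
    using X Y ij unfolding measurable_mat_def
    by (intro borel_measurable_sum borel_measurable_times) auto
  also have "?this \<longleftrightarrow> (\<lambda>\<omega>. (X \<omega> * Y \<omega>) $$ (i, j)) \<in> borel_measurable M"
  proof (intro measurable_cong)
    fix \<omega> assume "\<omega> \<in> space M"
    then have "X \<omega> \<in> carrier_mat n m" "Y \<omega> \<in> carrier_mat m p"
      using X Y unfolding measurable_mat_def by auto
    then show "(\<Sum>l<m. X \<omega> $$ (i, l) * Y \<omega> $$ (l, j)) = (X \<omega> * Y \<omega>) $$ (i, j)"
      using ij by (simp add: scalar_prod_def atLeast0LessThan)
  qed
  finally show "(\<lambda>\<omega>. (X \<omega> * Y \<omega>) $$ (i, j)) \<in> borel_measurable M" .
qed (use X Y in \<open>auto simp: measurable_mat_def\<close>)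

lemma measurable_mat_transpose:
  assumes X: "measurable_mat M n p X"
  shows "measurable_mat M p n (\<lambda>\<omega>. transpose_mat (X \<omega>))"
  unfolding measurable_mat_def
proof (intro conjI ballI allI impI)
  fix i j assume ij: "i < p" "j < n"
  have "(\<lambda>\<omega>. X \<omega> $$ (j, i)) \<in> borel_measurable M"
    using X ij unfolding measurable_mat_def by auto
  also have "?this \<longleftrightarrow> (\<lambda>\<omega>. transpose_mat (X \<omega>) $$ (i, j)) \<in> borel_measurable M"
    using X ij unfolding measurable_mat_def by (intro measurable_cong) fastforce
  finally show "(\<lambda>\<omega>. transpose_mat (X \<omega>) $$ (i, j)) \<in> borel_measurable M" .
qed (use X in \<open>auto simp: measurable_mat_def\<close>)

lemma borel_measurable_det:
  assumes X: "measurable_mat M p p X"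
  shows "(\<lambda>\<omega>. Determinant.det (X \<omega>)) \<in> borel_measurable M"
proof -
  have "(\<lambda>\<omega>. \<Sum>q\<in>{q. q permutes {0..<p}}. signof q * (\<Prod>i = 0..<p. X \<omega> $$ (i, q i))) \<in> borel_measurable M"
  proof (intro borel_measurable_sum borel_measurable_times borel_measurable_prod borel_measurable_const)
    fix q i assume "q \<in> {q. q permutes {0..<p}}" "i \<in> {0..<p}"
    then have "i < p" "q i < p" using permutes_in_image[of q "{0..<p}" i] by auto
    then show "(\<lambda>\<omega>. X \<omega> $$ (i, q i)) \<in> borel_measurable M"
      using X unfolding measurable_mat_def by auto
  qed
  also have "?this \<longleftrightarrow> (\<lambda>\<omega>. Determinant.det (X \<omega>)) \<in> borel_measurable M"
  proof (intro measurable_cong)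
    fix \<omega> assume "\<omega> \<in> space M"
    then have "X \<omega> \<in> carrier_mat p p" using X by (auto simp: measurable_mat_def)
    then show "(\<Sum>q\<in>{q. q permutes {0..<p}}. signof q * (\<Prod>i = 0..<p. X \<omega> $$ (i, q i)))
        = Determinant.det (X \<omega>)"
      by (simp only: det_def')
  qed
  finally show ?thesis .
qed

lemma measurable_mat_centered_pow:
  assumes G: "measurable_mat M p p G"
  shows "measurable_mat M p p (\<lambda>\<omega>. centered_pow p (G \<omega>) m)"
proof (induction m)
  case 0
  show ?case by (auto simp: measurable_mat_def)
next
  case (Suc m)
  have [measurable]: "(\<lambda>\<omega>. G \<omega> $$ (i, j)) \<in> borel_measurable M" if "i < p" "j < p" for i j
    using G that by (auto simp: measurable_mat_def)
  have "measurable_mat M p p (\<lambda>\<omega>. mat p p (\<lambda>(i, j). G \<omega> $$ (i, j) / (\<Sum>l<p. G \<omega> $$ (l, l))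
      - (if i = j then 1 else 0)))"
    unfolding measurable_mat_def
    by (auto intro!: borel_measurable_diff borel_measurable_divide borel_measurable_sum)
  from measurable_mat_mult[OF Suc this] show ?case by simp
qed

text \<open>Where the Gram determinant is nonzero, an entry is the sum of a series of measurable
  terms; elsewhere \<open>inv_sqrt_mat\<close> takes its default value, the zero matrix.\<close>

lemma measurable_mat_inv_sqrt_gram:
  assumes X: "measurable_mat M n p X"
  shows "measurable_mat M p p (\<lambda>\<omega>. inv_sqrt_mat (transpose_mat (X \<omega>) * X \<omega>))"
proof -
  define G where "G \<omega> = transpose_mat (X \<omega>) * X \<omega>" for \<omega>
  have G: "measurable_mat M p p G"
    unfolding G_def using measurable_mat_mult[OF measurable_mat_transpose[OF X] X] .
  note [measurable] = borel_measurable_det[OF G]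
  have Gc: "G \<omega> \<in> carrier_mat p p" if "\<omega> \<in> space M" for \<omega>
    using G that by (auto simp: measurable_mat_def)
  have "(\<lambda>\<omega>. inv_sqrt_mat (G \<omega>) $$ (i, j)) \<in> borel_measurable M" if ij: "i < p" "j < p" for i j
  proof -
    have [measurable]: "(\<lambda>\<omega>. G \<omega> $$ (i, j)) \<in> borel_measurable M" if "i < p" "j < p" for i j
      using G that by (auto simp: measurable_mat_def)
    have [measurable]: "(\<lambda>\<omega>. centered_pow p (G \<omega>) m $$ (i, j)) \<in> borel_measurable M" for m
      using measurable_mat_centered_pow[OF G] ij by (auto simp: measurable_mat_def)
    have [measurable]: "(\<lambda>\<omega>. \<Sum>l<p. G \<omega> $$ (l, l)) \<in> borel_measurable M"
      by (intro borel_measurable_sum) auto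
    have "(\<lambda>\<omega>. if Determinant.det (G \<omega>) \<noteq> 0 then
        (\<Sum>m. (-1/2 gchoose m) * centered_pow p (G \<omega>) m $$ (i, j) / sqrt (\<Sum>l<p. G \<omega> $$ (l, l)))
        else 0) \<in> borel_measurable M"
      by measurable
    also have "?this \<longleftrightarrow> (\<lambda>\<omega>. inv_sqrt_mat (G \<omega>) $$ (i, j)) \<in> borel_measurable M"
    proof (intro measurable_cong)
      fix \<omega> assume \<omega>: "\<omega> \<in> space M"
      then have Xc: "X \<omega> \<in> carrier_mat n p" using X by (auto simp: measurable_mat_def)
      show "(if Determinant.det (G \<omega>) \<noteq> 0 then
        (\<Sum>m. (-1/2 gchoose m) * centered_pow p (G \<omega>) m $$ (i, j) / sqrt (\<Sum>l<p. G \<omega> $$ (l, l)))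
        else 0) = inv_sqrt_mat (G \<omega>) $$ (i, j)"
      proof (cases "posdef_mat (G \<omega>)")
        case True
        then show ?thesis
          using posdef_gram_mat_iff_det[OF Xc] sums_unique[OF inv_sqrt_mat_index_sums[OF True Gc[OF \<omega>] ij]]
          by (simp add: G_def)
      next
        case False
        then show ?thesis
          using posdef_gram_mat_iff_det[OF Xc] ij Xc by (simp add: G_def inv_sqrt_mat_def)
      qed
    qed
    finally show ?thesis .
  qed
  then show ?thesis
    using Gc inv_sqrt_mat_carrier unfolding measurable_mat_def G_def by blast
qed

lemma measurable_mat_whitener:
  assumes X: "measurable_mat M n p X"
  shows "measurable_mat M p n (\<lambda>\<omega>. whitener (X \<omega>))"
  unfolding whitener_def
  by (rule measurable_mat_mult[OF measurable_mat_inv_sqrt_gram[OF X] measurable_mat_transpose[OF X]])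

lemma sets_posdef_gram_mat:
  assumes X: "measurable_mat M n p X"
  shows "{\<omega> \<in> space M. posdef_mat (transpose_mat (X \<omega>) * X \<omega>)} \<in> sets M"
proof -
  note [measurable] = borel_measurable_det[OF measurable_mat_mult[OF measurable_mat_transpose[OF X] X]]
  have "{\<omega> \<in> space M. Determinant.det (transpose_mat (X \<omega>) * X \<omega>) \<noteq> 0} \<in> sets M"
    by measurable
  also have "{\<omega> \<in> space M. Determinant.det (transpose_mat (X \<omega>) * X \<omega>) \<noteq> 0}
      = {\<omega> \<in> space M. posdef_mat (transpose_mat (X \<omega>) * X \<omega>)}"
    using X posdef_gram_mat_iff_det unfolding measurable_mat_def by blast
  finally show ?thesis .
qed

lemma borel_measurable_mat_mult_vec:
  assumes X: "measurable_mat M n p X" and v: "\<And>\<omega>. \<omega> \<in> space M \<Longrightarrow> v \<omega> \<in> carrier_vec p"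
    and vm: "\<And>j. j < p \<Longrightarrow> (\<lambda>\<omega>. v \<omega> $ j) \<in> borel_measurable M" and i: "i < n"
  shows "(\<lambda>\<omega>. (X \<omega> *\<^sub>v v \<omega>) $ i) \<in> borel_measurable M"
proof -
  have "(\<lambda>\<omega>. \<Sum>j<p. X \<omega> $$ (i, j) * v \<omega> $ j) \<in> borel_measurable M"
    using X vm i unfolding measurable_mat_def
    by (intro borel_measurable_sum borel_measurable_times) auto
  also have "?this \<longleftrightarrow> (\<lambda>\<omega>. (X \<omega> *\<^sub>v v \<omega>) $ i) \<in> borel_measurable M"
  proof (intro measurable_cong)
    fix \<omega> assume "\<omega> \<in> space M"
    then have "X \<omega> \<in> carrier_mat n p" "v \<omega> \<in> carrier_vec p"
      using X v unfolding measurable_mat_def by auto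
    then show "(\<Sum>j<p. X \<omega> $$ (i, j) * v \<omega> $ j) = (X \<omega> *\<^sub>v v \<omega>) $ i"
      using i by (simp add: scalar_prod_def atLeast0LessThan)
  qed
  finally show ?thesis .
qed

section \<open>Gaussian linear combinations with random coefficients\<close>

lemma (in prob_space) distributed_unit_combination_std_normal:
  fixes e :: "nat \<Rightarrow> 'a \<Rightarrow> real" and a :: "nat \<Rightarrow> real"
  assumes indep: "indep_vars (\<lambda>_. borel) e {..<n}"
    and normal: "\<And>i. i < n \<Longrightarrow> distributed M lborel (e i) (\<lambda>x. ennreal (std_normal_density x))"
    and a: "(\<Sum>i<n. (a i)\<^sup>2) = 1"
  shows "distributed M lborel (\<lambda>\<omega>. \<Sum>i<n. a i * e i \<omega>) (\<lambda>x. ennreal (std_normal_density x))"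
proof -
  \<comment> \<open>Zero coefficients are dropped because a degenerate normal variable has no
    density. The unit norm of a guarantees that some coefficient remains.\<close>
  define I where "I = {i. i < n \<and> a i \<noteq> 0}"
  have I: "finite I" "I \<subseteq> {..<n}" by (auto simp: I_def)
  have aI: "(\<Sum>i\<in>I. (a i)\<^sup>2) = 1"
    unfolding a[symmetric] by (rule sum.mono_neutral_left) (auto simp: I_def)
  then have "I \<noteq> {}" by auto
  have "indep_vars (\<lambda>_. borel) (\<lambda>i \<omega>. a i * e i \<omega>) I"
    by (rule indep_vars_compose2[OF indep_vars_subset[OF indep I(2)]]) simp
  moreover have "distributed M lborel (\<lambda>\<omega>. a i * e i \<omega>) (normal_density 0 \<bar>a i\<bar>)" if "i \<in> I" for i
    using normal_density_affine[of "e i" 0 1 "a i" 0] normal[of i] that by (auto simp: I_def)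
  ultimately have "distributed M lborel (\<lambda>\<omega>. \<Sum>i\<in>I. a i * e i \<omega>)
      (normal_density (\<Sum>i\<in>I. 0) (sqrt (\<Sum>i\<in>I. \<bar>a i\<bar>\<^sup>2)))"
    using I \<open>I \<noteq> {}\<close> by (intro sum_indep_normal) (auto simp: I_def)
  moreover have "(\<Sum>i\<in>I. a i * e i \<omega>) = (\<Sum>i<n. a i * e i \<omega>)" for \<omega>
    by (rule sum.mono_neutral_left) (auto simp: I_def)
  ultimately show ?thesis by (simp add: aI)
qed

text \<open>Conditioning on Y: independence makes the joint law a product, so y can be frozen by
  Fubini. For almost every y the inner probability concerns a fixed unit combination of the noise
  and equals the normal measure of B, a constant that survives integration over y.\<close>

lemma (in prob_space) emeasure_random_unit_combination_std_normal:
  fixes e :: "nat \<Rightarrow> 'a \<Rightarrow> real" and a :: "(nat \<times> nat \<Rightarrow> real) \<Rightarrow> nat \<Rightarrow> real"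
  assumes indep: "indep_vars (\<lambda>_. borel) e {..<n}"
    and normal: "\<And>i. i < n \<Longrightarrow> distributed M lborel (e i) (\<lambda>x. ennreal (std_normal_density x))"
    and indep_var: "indep_var K Y (PiM ({..<n} \<times> {0::nat}) (\<lambda>_. borel))
      (\<lambda>\<omega>. restrict (\<lambda>(i, _). e i \<omega>) ({..<n} \<times> {0}))"
    and meas: "\<And>i. i < n \<Longrightarrow> (\<lambda>y. a y i) \<in> borel_measurable K"
    and unit: "AE y in distr M K Y. (\<Sum>i<n. (a y i)\<^sup>2) = 1"
    and B[measurable]: "B \<in> sets borel"
  shows "emeasure M {\<omega> \<in> space M. (\<Sum>i<n. a (Y \<omega>) i * e i \<omega>) \<in> B}
     = emeasure (density lborel (\<lambda>x. ennreal (std_normal_density x))) B"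
proof -
  let ?Ke = "PiM ({..<n} \<times> {0::nat}) (\<lambda>_. borel :: real measure)"
  let ?E = "\<lambda>\<omega>. restrict (\<lambda>(i, _). e i \<omega>) ({..<n} \<times> {0::nat})"
  have Y[measurable]: "Y \<in> measurable M K" and E[measurable]: "?E \<in> measurable M ?Ke"
    using indep_var_rv1[OF indep_var] indep_var_rv2[OF indep_var] by auto
  define g where "g = (\<lambda>(y, w). \<Sum>i<n. a y i * w (i, 0::nat))"
  note [measurable] = meas
  have g[measurable]: "g \<in> borel_measurable (K \<Otimes>\<^sub>M ?Ke)"
    unfolding g_def case_prod_beta
  proof (intro borel_measurable_sum borel_measurable_times)
    fix i assume i: "i \<in> {..<n}"
    then have [measurable]: "(\<lambda>y. a y i) \<in> borel_measurable K" using meas by simp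
    show "(\<lambda>x. a (fst x) i) \<in> borel_measurable (K \<Otimes>\<^sub>M ?Ke)" by measurable
    have [measurable]: "(\<lambda>w. w (i, 0)) \<in> borel_measurable ?Ke"
      using i by (intro measurable_component_singleton) auto
    show "(\<lambda>x. snd x (i, 0)) \<in> borel_measurable (K \<Otimes>\<^sub>M ?Ke)" by measurable
  qed
  define C where "C = g -` B \<inter> space (K \<Otimes>\<^sub>M ?Ke)"
  have C[measurable]: "C \<in> sets (K \<Otimes>\<^sub>M ?Ke)" unfolding C_def by measurable
  interpret DE: prob_space "distr M ?Ke ?E" by (rule prob_space_distr) simp
  have "emeasure M {\<omega> \<in> space M. (\<Sum>i<n. a (Y \<omega>) i * e i \<omega>) \<in> B}
      = emeasure (distr M (K \<Otimes>\<^sub>M ?Ke) (\<lambda>\<omega>. (Y \<omega>, ?E \<omega>))) C"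
  proof (subst emeasure_distr)
    show "emeasure M {\<omega> \<in> space M. (\<Sum>i<n. a (Y \<omega>) i * e i \<omega>) \<in> B}
        = emeasure M ((\<lambda>\<omega>. (Y \<omega>, ?E \<omega>)) -` C \<inter> space M)"
    proof (rule arg_cong[of _ _ "emeasure M"])
      have "(Y \<omega>, ?E \<omega>) \<in> space (K \<Otimes>\<^sub>M ?Ke)" if "\<omega> \<in> space M" for \<omega>
        using measurable_space[OF Y that] measurable_space[OF E that] by (simp add: space_pair_measure)
      then show "{\<omega> \<in> space M. (\<Sum>i<n. a (Y \<omega>) i * e i \<omega>) \<in> B} = (\<lambda>\<omega>. (Y \<omega>, ?E \<omega>)) -` C \<inter> space M"
        by (auto simp: C_def g_def)
    qed
  qed (rule measurable_Pair[OF Y E], rule C)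
  also have "distr M (K \<Otimes>\<^sub>M ?Ke) (\<lambda>\<omega>. (Y \<omega>, ?E \<omega>)) = distr M K Y \<Otimes>\<^sub>M distr M ?Ke ?E"
    using indep_var unfolding indep_var_distribution_eq by simp
  also have "emeasure \<dots> C = (\<integral>\<^sup>+y. emeasure (distr M ?Ke ?E) (Pair y -` C) \<partial>distr M K Y)"
    by (rule DE.emeasure_pair_measure_alt) simp
  also have "\<dots> = (\<integral>\<^sup>+y. emeasure (density lborel (\<lambda>x. ennreal (std_normal_density x))) B \<partial>distr M K Y)"
  proof (rule nn_integral_cong_AE, use unit AE_space in eventually_elim)
    fix y assume y: "(\<Sum>i<n. (a y i)\<^sup>2) = 1" "y \<in> space (distr M K Y)"
    have sp: "?E \<omega> \<in> space ?Ke" if "\<omega> \<in> space M" for \<omega>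
      using measurable_space[OF E that] .
    have "emeasure (distr M ?Ke ?E) (Pair y -` C)
        = emeasure M (?E -` (Pair y -` C) \<inter> space M)"
      by (rule emeasure_distr) (use sets_Pair1[OF C] in auto)
    also have "?E -` (Pair y -` C) \<inter> space M = (\<lambda>\<omega>. \<Sum>i<n. a y i * e i \<omega>) -` B \<inter> space M"
      using y(2) sp by (auto simp: C_def g_def space_pair_measure)
    also have "emeasure M \<dots> = emeasure (distr M lborel (\<lambda>\<omega>. \<Sum>i<n. a y i * e i \<omega>)) B"
      using distributed_unit_combination_std_normal[OF indep normal y(1)]
      by (subst emeasure_distr) (auto simp: distributed_def)
    also have "\<dots> = emeasure (density lborel (\<lambda>x. ennreal (std_normal_density x))) B"
      using distributed_unit_combination_std_normal[OF indep normal y(1)]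
      by (simp add: distributed_def)
    finally show "emeasure (distr M ?Ke ?E) (Pair y -` C)
        = emeasure (density lborel (\<lambda>x. ennreal (std_normal_density x))) B" .
  qed
  also have "\<dots> = emeasure (density lborel (\<lambda>x. ennreal (std_normal_density x))) B"
    using prob_space.emeasure_space_1[OF prob_space_distr[OF Y]] by simp
  finally show ?thesis .
qed

section \<open>Tail bounds for the standard normal law\<close>

abbreviation std_normal :: "real measure" where
  "std_normal \<equiv> density lborel (\<lambda>x. ennreal (std_normal_density x))"

lemma prob_space_std_normal: "prob_space std_normal"
  by (rule prob_space_normal_density) simp

text \<open>On the interval (t, t + 1), of length 1, the density is at least its value at the right
  end. This is the origin of the summand 1 in the later thresholds.\<close>

lemma std_normal_tail_lower:
  assumes t: "t \<ge> 0"
  shows "std_normal_density (t + 1) \<le> measure std_normal {x. \<bar>x\<bar> > t}"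
proof -
  interpret prob_space std_normal by (rule prob_space_std_normal)
  have "ennreal (std_normal_density (t + 1)) = (\<integral>\<^sup>+x. ennreal (std_normal_density (t + 1)) * indicator {t<..<t+1} x \<partial>lborel)"
    using t by (simp add: nn_integral_cmult_indicator)
  also have "\<dots> \<le> (\<integral>\<^sup>+x. ennreal (std_normal_density x) * indicator {x. \<bar>x\<bar> > t} x \<partial>lborel)"
    using t by (intro nn_integral_mono)
      (auto simp: indicator_def std_normal_density_def intro!: ennreal_leI divide_right_mono power_mono)
  also have "\<dots> = emeasure std_normal {x. \<bar>x\<bar> > t}"
    by (rule emeasure_density[symmetric]) auto
  finally show ?thesis
    by (simp add: emeasure_eq_measure)
qed

text \<open>Exponential tilting with m = t or m = -t: on the event m x > t^2 the density is at most
  exp (m x - t^2) times itself, which is exp (- t^2 / 2) times the normal density centred at m. That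
  density integrates to 1.\<close>

lemma std_normal_tail_upper:
  assumes t: "t \<ge> 0"
  shows "measure std_normal {x. \<bar>x\<bar> > t} \<le> 2 * exp (- t\<^sup>2 / 2)"
proof -
  interpret prob_space std_normal by (rule prob_space_std_normal)
  have shift: "std_normal_density x * exp (m * x) = exp (m\<^sup>2 / 2) * normal_density m 1 x" for m x :: real
    by (simp add: normal_density_def exp_add[symmetric] power2_eq_square field_simps)
  have N: "(\<integral>\<^sup>+x. ennreal (normal_density m 1 x) \<partial>lborel) = 1" for m :: real
    by (subst nn_integral_eq_integral) auto
  have one: "emeasure std_normal {x. m * x > t * t} \<le> ennreal (exp (- t\<^sup>2 / 2))" if m: "\<bar>m\<bar> = t" for m
  proof -
    have "emeasure std_normal {x. m * x > t * t}
        = (\<integral>\<^sup>+x. ennreal (std_normal_density x) * indicator {x. m * x > t * t} x \<partial>lborel)"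
      by (rule emeasure_density) auto
    also have "\<dots> \<le> (\<integral>\<^sup>+x. ennreal (exp (- t\<^sup>2 / 2)) * ennreal (normal_density m 1 x) \<partial>lborel)"
    proof (rule nn_integral_mono)
      fix x
      show "ennreal (std_normal_density x) * indicator {x. m * x > t * t} x
          \<le> ennreal (exp (- t\<^sup>2 / 2)) * ennreal (normal_density m 1 x)"
      proof (cases "m * x > t * t")
        case True
        have "std_normal_density x \<le> std_normal_density x * exp (m * x - t\<^sup>2)"
          using True mult_left_mono[of 1 "exp (m * x - t\<^sup>2)" "std_normal_density x"]
          by (simp add: power2_eq_square)
        also have "\<dots> = exp (- t\<^sup>2) * (std_normal_density x * exp (m * x))"
          by (simp add: exp_diff exp_minus field_simps)
        also have "\<dots> = exp (- t\<^sup>2) * exp (t\<^sup>2 / 2) * normal_density m 1 x"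
          unfolding shift using m by (simp add: mult.assoc) (metis power2_abs)
        also have "exp (- t\<^sup>2) * exp (t\<^sup>2 / 2) = exp (- t\<^sup>2 / 2)"
          by (simp add: exp_add[symmetric])
        finally show ?thesis using True by (simp add: ennreal_mult[symmetric])
      qed simp
    qed
    also have "\<dots> = ennreal (exp (- t\<^sup>2 / 2))"
      by (subst nn_integral_cmult) (auto simp: N)
    finally show ?thesis .
  qed
  show ?thesis
  \<comment> \<open>For t = 0 the two tilted events are empty and do not cover the tail, but then
    the claimed bound is 2.\<close>
  proof (cases "t = 0")
    case True
    then show ?thesis by (simp add: order_trans[OF prob_le_1])
  next
    case False
    have "{x. \<bar>x\<bar> > t} \<subseteq> {x. t * x > t * t} \<union> {x. - t * x > t * t}"
    proof
      fix x assume "x \<in> {x. \<bar>x\<bar> > t}"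
      then have "x > t \<or> - x > t" by auto
      then show "x \<in> {x. t * x > t * t} \<union> {x. - t * x > t * t}"
        using t False mult_strict_left_mono[of t x t] mult_strict_left_mono[of t "- x" t] by auto
    qed
    then have "measure std_normal {x. \<bar>x\<bar> > t}
        \<le> measure std_normal ({x. t * x > t * t} \<union> {x. - t * x > t * t})"
      by (intro finite_measure_mono) auto
    also have "\<dots> \<le> measure std_normal {x. t * x > t * t} + measure std_normal {x. - t * x > t * t}"
      by (intro measure_Un_le) auto
    also have "\<dots> \<le> exp (- t\<^sup>2 / 2) + exp (- t\<^sup>2 / 2)"
      using one[of t] one[of "- t"] t by (intro add_mono) (auto simp: emeasure_eq_measure)
    finally show ?thesis by simp
  qed
qed

section \<open>Risk of the max test for a fixed model\<close>

context
  fixes M :: "'w measure" and X :: "'w \<Rightarrow> real mat" and eps :: "'w \<Rightarrow> real vec" and n p :: nat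
  assumes model: "model_setup M X eps n p"
begin

lemma model_prob_space: "prob_space M"
  using model by (simp add: model_setup_def)

interpretation prob_space M by (rule model_prob_space)

lemma model_carrier: "\<omega> \<in> space M \<Longrightarrow> X \<omega> \<in> carrier_mat n p" "\<omega> \<in> space M \<Longrightarrow> eps \<omega> \<in> carrier_vec n"
  using model by (auto simp: model_setup_def)

lemma measurable_mat_design: "measurable_mat M n p X"
proof -
  let ?I = "{..<n} \<times> {..<p}"
  have X: "(\<lambda>\<omega>. restrict (\<lambda>(i, j). X \<omega> $$ (i, j)) ?I) \<in> measurable M (PiM ?I (\<lambda>_. borel))"
    using model indep_var_rv1 unfolding model_setup_def by blast
  show ?thesis
    unfolding measurable_mat_def
  proof (intro conjI ballI allI impI)
    fix i j assume ij: "i < n" "j < p"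
    then have "(\<lambda>f. f (i, j)) \<in> borel_measurable (PiM ?I (\<lambda>_. borel :: real measure))"
      by (intro measurable_component_singleton) auto
    from measurable_compose[OF X this] show "(\<lambda>\<omega>. X \<omega> $$ (i, j)) \<in> borel_measurable M"
      using ij by simp
  qed (use model_carrier in auto)
qed

lemma borel_measurable_noise: "i < n \<Longrightarrow> (\<lambda>\<omega>. eps \<omega> $ i) \<in> borel_measurable M"
  using model unfolding model_setup_def distributed_def by auto

lemma borel_measurable_whitened_noise:
  assumes "j < p"
  shows "(\<lambda>\<omega>. (whitener (X \<omega>) *\<^sub>v eps \<omega>) $ j) \<in> borel_measurable M"
  using assms model_carrier borel_measurable_noise
  by (intro borel_measurable_mat_mult_vec[OF measurable_mat_whitener[OF measurable_mat_design]]) auto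

lemma borel_measurable_z_stat:
  assumes b: "b \<in> carrier_vec p" and j: "j < p"
  shows "(\<lambda>\<omega>. z_stat (X \<omega>) (X \<omega> *\<^sub>v b + eps \<omega>) $ j) \<in> borel_measurable M"
proof -
  have "(\<lambda>\<omega>. (whitener (X \<omega>) *\<^sub>v (X \<omega> *\<^sub>v b + eps \<omega>)) $ j) \<in> borel_measurable M"
  proof (rule borel_measurable_mat_mult_vec[OF measurable_mat_whitener[OF measurable_mat_design] _ _ j])
    show "X \<omega> *\<^sub>v b + eps \<omega> \<in> carrier_vec n" if "\<omega> \<in> space M" for \<omega>
      using model_carrier[OF that] b by auto
    fix i assume i: "i < n"
    have "(\<lambda>\<omega>. (X \<omega> *\<^sub>v b) $ i + eps \<omega> $ i) \<in> borel_measurable M"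
      using i b by (intro borel_measurable_add borel_measurable_noise
        borel_measurable_mat_mult_vec[OF measurable_mat_design]) auto
    also have "?this \<longleftrightarrow> (\<lambda>\<omega>. (X \<omega> *\<^sub>v b + eps \<omega>) $ i) \<in> borel_measurable M"
    proof (intro measurable_cong)
      fix \<omega> assume "\<omega> \<in> space M"
      from model_carrier(2)[OF this] show "(X \<omega> *\<^sub>v b) $ i + eps \<omega> $ i = (X \<omega> *\<^sub>v b + eps \<omega>) $ i"
        using i by simp
    qed
    finally show "(\<lambda>\<omega>. (X \<omega> *\<^sub>v b + eps \<omega>) $ i) \<in> borel_measurable M" .
  qed
  also have "?this \<longleftrightarrow> ?thesis"
  proof (intro measurable_cong)
    fix \<omega> assume "\<omega> \<in> space M"
    note c = model_carrier[OF this]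
    then have "X \<omega> *\<^sub>v b + eps \<omega> \<in> carrier_vec n" using b by auto
    from z_stat_whitener[OF c(1) this]
    show "(whitener (X \<omega>) *\<^sub>v (X \<omega> *\<^sub>v b + eps \<omega>)) $ j = z_stat (X \<omega>) (X \<omega> *\<^sub>v b + eps \<omega>) $ j"
      by simp
  qed
  finally show ?thesis .
qed

text \<open>Given X, a noise coordinate is the combination of the errors along a row of the
  whitener, which is almost surely a unit vector.\<close>

lemma whitened_noise_std_normal:
  assumes pd: "AE \<omega> in M. posdef_mat (transpose_mat (X \<omega>) * X \<omega>)"
    and j: "j < p" and B: "B \<in> sets borel"
  shows "prob {\<omega> \<in> space M. (whitener (X \<omega>) *\<^sub>v eps \<omega>) $ j \<in> B} = measure std_normal B"
proof -
  let ?I = "{..<n} \<times> {..<p}"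
  let ?K = "PiM ?I (\<lambda>_. borel :: real measure)"
  let ?Y = "\<lambda>\<omega>. restrict (\<lambda>(i, j). X \<omega> $$ (i, j)) ?I"
  \<comment> \<open>Independence in \<open>model_setup\<close> is stated for the array of entries of
    X, so the coefficients are written as functions of that array; \<open>mat n p\<close> rebuilds X
    from it.\<close>
  define a where "a y i = whitener (mat n p y) $$ (j, i)" for y i
  have YX: "mat n p (?Y \<omega>) = X \<omega>" if "\<omega> \<in> space M" for \<omega>
    using model_carrier(1)[OF that] by (intro eq_matI) auto
  have indep: "indep_vars (\<lambda>_. borel) (\<lambda>i \<omega>. eps \<omega> $ i) {..<n}"
    and normal: "\<And>i. i < n \<Longrightarrow> distributed M lborel (\<lambda>\<omega>. eps \<omega> $ i) (\<lambda>x. ennreal (std_normal_density x))"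
    and indep_var: "indep_var ?K ?Y (PiM ({..<n} \<times> {0::nat}) (\<lambda>_. borel))
      (\<lambda>\<omega>. restrict (\<lambda>(i, _). eps \<omega> $ i) ({..<n} \<times> {0}))"
    using model unfolding model_setup_def by auto
  have mat: "measurable_mat ?K n p (mat n p)"
    unfolding measurable_mat_def by (auto intro!: measurable_component_singleton)
  have meas: "(\<lambda>y. a y i) \<in> borel_measurable ?K" if "i < n" for i
    using measurable_mat_whitener[OF mat] that j unfolding a_def measurable_mat_def by auto
  have "AE y in distr M ?K ?Y. posdef_mat (transpose_mat (mat n p y) * mat n p y)"
    by (subst AE_distr_iff[OF indep_var_rv1[OF indep_var] sets_posdef_gram_mat[OF mat]])
      (use pd AE_space in eventually_elim, simp only: YX)
  then have unit: "AE y in distr M ?K ?Y. (\<Sum>i<n. (a y i)\<^sup>2) = 1"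
    by eventually_elim (auto simp: a_def intro!: sum_squares_whitener[of _ n p] j)
  have "(\<Sum>i<n. a (?Y \<omega>) i * eps \<omega> $ i) = (whitener (X \<omega>) *\<^sub>v eps \<omega>) $ j" if "\<omega> \<in> space M" for \<omega>
    using model_carrier[OF that] whitener_carrier[OF model_carrier(1)[OF that]] j
    unfolding a_def YX[OF that] by (simp add: scalar_prod_def atLeast0LessThan)
  then have "{\<omega> \<in> space M. (whitener (X \<omega>) *\<^sub>v eps \<omega>) $ j \<in> B}
      = {\<omega> \<in> space M. (\<Sum>i<n. a (?Y \<omega>) i * eps \<omega> $ i) \<in> B}" by auto
  then show ?thesis
    using emeasure_random_unit_combination_std_normal[OF indep normal indep_var meas unit B]
    by (simp add: measure_def)
qed

lemma E_beta_xi_test: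
  assumes b: "b \<in> carrier_vec p"
  defines "R t \<equiv> {\<omega> \<in> space M. \<exists>j<p. \<bar>z_stat (X \<omega>) (X \<omega> *\<^sub>v b + eps \<omega>) $ j\<bar> > t}"
  shows "R t \<in> sets M" "E_beta M X eps (xi_test t) b = prob (R t)"
    "E_beta M X eps (\<lambda>y Z. 1 - xi_test t y Z) b = 1 - prob (R t)"
proof -
  have "R t = (\<Union>j<p. {\<omega> \<in> space M. \<bar>z_stat (X \<omega>) (X \<omega> *\<^sub>v b + eps \<omega>) $ j\<bar> > t})"
    by (auto simp: R_def)
  also have "\<dots> \<in> sets M"
  proof (intro sets.finite_UN)
    fix j assume "j \<in> {..<p}"
    then have [measurable]: "(\<lambda>\<omega>. z_stat (X \<omega>) (X \<omega> *\<^sub>v b + eps \<omega>) $ j) \<in> borel_measurable M"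
      using borel_measurable_z_stat[OF b] by simp
    show "{\<omega> \<in> space M. \<bar>z_stat (X \<omega>) (X \<omega> *\<^sub>v b + eps \<omega>) $ j\<bar> > t} \<in> sets M" by measurable
  qed simp
  finally show R[measurable]: "R t \<in> sets M" .
  have "dim_vec (z_stat (X \<omega>) (X \<omega> *\<^sub>v b + eps \<omega>)) = p" if "\<omega> \<in> space M" for \<omega>
    using z_stat_whitener[of "X \<omega>" n p "X \<omega> *\<^sub>v b + eps \<omega>"] whitener_carrier[of "X \<omega>" n p]
      model_carrier[OF that] b by auto
  then have xi: "xi_test t (X \<omega> *\<^sub>v b + eps \<omega>) (X \<omega>) = indicator (R t) \<omega>" if "\<omega> \<in> space M" for \<omega>
    using that by (auto simp: xi_test_def R_def indicator_def)
  have "E_beta M X eps (xi_test t) b = (\<integral>\<omega>. indicator (R t) \<omega> \<partial>M)"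
    unfolding E_beta_def by (rule Bochner_Integration.integral_cong) (auto simp: xi)
  also have "\<dots> = prob (R t)" by simp
  finally show "E_beta M X eps (xi_test t) b = prob (R t)" .
  have "E_beta M X eps (\<lambda>y Z. 1 - xi_test t y Z) b = (\<integral>\<omega>. 1 - indicator (R t) \<omega> \<partial>M)"
    unfolding E_beta_def by (rule Bochner_Integration.integral_cong) (auto simp: xi)
  also have "\<dots> = 1 - prob (R t)"
    by (subst Bochner_Integration.integral_diff[OF _ integrable_real_indicator[OF R]])
      (auto simp: prob_space emeasure_eq_measure)
  finally show "E_beta M X eps (\<lambda>y Z. 1 - xi_test t y Z) b = 1 - prob (R t)" .
qed

text \<open>The numbers a, \<kappa> and u bound the scaled signal, the deviation of G^(1/2) b from
  sqrt n b, and the noise maximum. When all three bounds hold, every |z_j| is at most t0 = a +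
  \<kappa> + u, so t0 separates thresholds with a substantial type I error from those with a type II
  error of at least 1/2.\<close>

lemma Risk_lower_bound:
  assumes pd: "AE \<omega> in M. posdef_mat (transpose_mat (X \<omega>) * X \<omega>)"
    and p: "0 < p" and n: "0 < n" and b: "b \<in> Xi p s A"
    and close: "prob {\<omega> \<in> space M. real n * \<kappa>\<^sup>2 <
        (\<Sum>i<p. (((transpose_mat (X \<omega>) * X \<omega>) *\<^sub>v b) $ i - real n * b $ i)\<^sup>2)} \<le> 1/4"
    and \<kappa>: "0 \<le> \<kappa>" and u: "0 \<le> u" "2 * real p * exp (- u\<^sup>2 / 2) \<le> 1/4"
    and a: "\<And>j. j < p \<Longrightarrow> sqrt (real n) * \<bar>b $ j\<bar> \<le> a"
  shows "min (std_normal_density (a + \<kappa> + u + 1)) (1/2) \<le> Risk M X eps p (xi_test t) s A"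
proof -
  define t0 where "t0 = a + \<kappa> + u"
  define R where "R b t = {\<omega> \<in> space M. \<exists>j<p. \<bar>z_stat (X \<omega>) (X \<omega> *\<^sub>v b + eps \<omega>) $ j\<bar> > t}" for b t
  have bc: "b \<in> carrier_vec p" using b by (auto simp: Xi_def intro: carrier_vecI)
  note Eb = E_beta_xi_test[OF bc, folded R_def]
  note E0 = E_beta_xi_test[OF zero_carrier_vec, folded R_def]
  have a0: "0 \<le> a" using a[OF p] by (rule order_trans[rotated]) simp
  have t0: "0 \<le> t0" using a0 \<kappa> u(1) by (simp add: t0_def)
  \<comment> \<open>A supremum of reals dominates its members only when the family is bounded above;
    here the bound is 1.\<close>
  have sup: "1 - prob (R b t) \<le> (SUP \<beta> \<in> Xi p s A. E_beta M X eps (\<lambda>y Z. 1 - xi_test t y Z) \<beta>)"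
  proof -
    have "E_beta M X eps (\<lambda>y Z. 1 - xi_test t y Z) \<beta> \<le> 1" if "\<beta> \<in> Xi p s A" for \<beta>
    proof -
      have "\<beta> \<in> carrier_vec p" using that by (auto simp: Xi_def intro: carrier_vecI)
      from E_beta_xi_test(3)[OF this] show ?thesis by simp
    qed
    then have "bdd_above ((\<lambda>\<beta>. E_beta M X eps (\<lambda>y Z. 1 - xi_test t y Z) \<beta>) ` Xi p s A)"
      by (auto simp: bdd_above_def)
    from cSUP_upper[OF b this] show ?thesis unfolding Eb(3) .
  qed
  have risk: "prob (R (0\<^sub>v p) t) + (1 - prob (R b t)) \<le> Risk M X eps p (xi_test t) s A"
    unfolding Risk_def E0(2) using sup by simp
  show ?thesis
  proof (cases "t \<le> t0")
    case True
    \<comment> \<open>One coordinate suffices under the null hypothesis: the test rejects whenever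
      |z_0| > t0, since t0 >= t.\<close>
    have "std_normal_density (t0 + 1) \<le> measure std_normal {x. \<bar>x\<bar> > t0}"
      by (rule std_normal_tail_lower[OF t0])
    also have "\<dots> = prob {\<omega> \<in> space M. (whitener (X \<omega>) *\<^sub>v eps \<omega>) $ 0 \<in> {x. \<bar>x\<bar> > t0}}"
      by (rule whitened_noise_std_normal[OF pd p, symmetric]) simp
    also have "\<dots> \<le> prob (R (0\<^sub>v p) t)"
    proof (rule finite_measure_mono[OF _ E0(1)], rule subsetI)
      fix \<omega> assume \<omega>: "\<omega> \<in> {\<omega> \<in> space M. (whitener (X \<omega>) *\<^sub>v eps \<omega>) $ 0 \<in> {x. \<bar>x\<bar> > t0}}"
      then have c: "X \<omega> \<in> carrier_mat n p" "eps \<omega> \<in> carrier_vec n" using model_carrier by auto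
      have "X \<omega> *\<^sub>v 0\<^sub>v p = 0\<^sub>v n" using c by (intro eq_vecI) auto
      then have "X \<omega> *\<^sub>v 0\<^sub>v p + eps \<omega> = eps \<omega>" using c by simp
      then show "\<omega> \<in> R (0\<^sub>v p) t"
        using \<omega> True p z_stat_whitener[OF c] by (auto simp: R_def intro!: exI[of _ 0])
    qed
    finally have "std_normal_density (t0 + 1) \<le> prob (R (0\<^sub>v p) t)" .
    moreover have "prob (R b t) \<le> 1" by simp
    ultimately have "std_normal_density (t0 + 1) \<le> Risk M X eps p (xi_test t) s A"
      using risk by linarith
    then show ?thesis by (simp add: t0_def min.coboundedI1)
  next
    case False
    define F where "F = {\<omega> \<in> space M. \<not> posdef_mat (transpose_mat (X \<omega>) * X \<omega>)}"
    define H where "H = {\<omega> \<in> space M. real n * \<kappa>\<^sup>2 <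
        (\<Sum>i<p. (((transpose_mat (X \<omega>) * X \<omega>) *\<^sub>v b) $ i - real n * b $ i)\<^sup>2)}"
    define N where "N j = {\<omega> \<in> space M. (whitener (X \<omega>) *\<^sub>v eps \<omega>) $ j \<in> {x. \<bar>x\<bar> > u}}" for j
    have "F = space M - {\<omega> \<in> space M. posdef_mat (transpose_mat (X \<omega>) * X \<omega>)}"
      by (auto simp: F_def)
    then have F: "F \<in> sets M"
      using sets_posdef_gram_mat[OF measurable_mat_design] by auto
    have F0: "prob F = 0"
      using pd F AE_iff_measurable[OF F, of "\<lambda>\<omega>. posdef_mat (transpose_mat (X \<omega>) * X \<omega>)"]
      by (simp add: F_def measure_def)
    have H: "H \<in> sets M"
    proof -
      have "(\<lambda>\<omega>. (((transpose_mat (X \<omega>) * X \<omega>) *\<^sub>v b) $ i)) \<in> borel_measurable M" if "i < p" for i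
        using that bc measurable_mat_mult[OF measurable_mat_transpose measurable_mat_design,
            OF measurable_mat_design]
        by (intro borel_measurable_mat_mult_vec) auto
      then have [measurable]: "(\<lambda>\<omega>. \<Sum>i<p. (((transpose_mat (X \<omega>) * X \<omega>) *\<^sub>v b) $ i - real n * b $ i)\<^sup>2)
          \<in> borel_measurable M"
        by (intro borel_measurable_sum borel_measurable_power borel_measurable_diff) auto
      show ?thesis unfolding H_def by measurable
    qed
    have N: "N j \<in> sets M" if "j < p" for j
    proof -
      note [measurable] = borel_measurable_whitened_noise[OF that]
      show ?thesis unfolding N_def by measurable
    qed
    have NU: "prob (\<Union>j<p. N j) \<le> 1/4"
    proof -
      have "prob (\<Union>j<p. N j) \<le> (\<Sum>j<p. prob (N j))"
        using N by (intro finite_measure_subadditive_finite) auto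
      also have "\<dots> \<le> (\<Sum>j<p. 2 * exp (- u\<^sup>2 / 2))"
        using whitened_noise_std_normal[OF pd, of _ "{x. \<bar>x\<bar> > u}"] std_normal_tail_upper[OF u(1)]
        by (intro sum_mono) (simp add: N_def)
      also have "\<dots> \<le> 1/4" using u(2) by simp
      finally show ?thesis .
    qed
    \<comment> \<open>A rejection with t > t0 requires a Gram matrix that is not positive definite
      (probability 0), a large matrix error (at most 1/4) or a large noise coordinate (at most
      1/4).\<close>
    have "R b t \<subseteq> (F \<union> H) \<union> (\<Union>j<p. N j)"
    proof
      fix \<omega> assume "\<omega> \<in> R b t"
      then obtain j where \<omega>: "\<omega> \<in> space M" and j: "j < p"
        and z: "\<bar>z_stat (X \<omega>) (X \<omega> *\<^sub>v b + eps \<omega>) $ j\<bar> > t" by (auto simp: R_def)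
      show "\<omega> \<in> (F \<union> H) \<union> (\<Union>j<p. N j)"
      proof (rule ccontr)
        assume contra: "\<not> ?thesis"
        note c = model_carrier[OF \<omega>]
        note V = whitener_carrier[OF c(1)]
        have pdw: "posdef_mat (transpose_mat (X \<omega>) * X \<omega>)"
          and small: "(\<Sum>i<p. (((transpose_mat (X \<omega>) * X \<omega>) *\<^sub>v b) $ i - real n * b $ i)\<^sup>2) \<le> real n * \<kappa>\<^sup>2"
          and noise: "\<bar>(whitener (X \<omega>) *\<^sub>v eps \<omega>) $ j\<bar> \<le> u"
          using contra \<omega> j by (auto simp: F_def H_def N_def not_less)
        have "z_stat (X \<omega>) (X \<omega> *\<^sub>v b + eps \<omega>) = whitener (X \<omega>) *\<^sub>v (X \<omega> *\<^sub>v b + eps \<omega>)"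
          using c bc by (intro z_stat_whitener) auto
        also have "\<dots> = whitener (X \<omega>) *\<^sub>v (X \<omega> *\<^sub>v b) + whitener (X \<omega>) *\<^sub>v eps \<omega>"
          using c V bc by (intro mult_add_distrib_mat_vec) auto
        also have "whitener (X \<omega>) *\<^sub>v (X \<omega> *\<^sub>v b) = (whitener (X \<omega>) * X \<omega>) *\<^sub>v b"
          using c V bc by (intro assoc_mult_mat_vec[symmetric]) auto
        finally have zj: "z_stat (X \<omega>) (X \<omega> *\<^sub>v b + eps \<omega>) $ j
            = ((whitener (X \<omega>) * X \<omega>) *\<^sub>v b) $ j + (whitener (X \<omega>) *\<^sub>v eps \<omega>) $ j"
          using c V j by simp
        have "sqrt (real n) * \<bar>((whitener (X \<omega>) * X \<omega>) *\<^sub>v b) $ j - sqrt (real n) * b $ j\<bar>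
            \<le> sqrt (\<Sum>i<p. (((transpose_mat (X \<omega>) * X \<omega>) *\<^sub>v b) $ i - (sqrt (real n))\<^sup>2 * b $ i)\<^sup>2)"
          by (rule whitener_mult_near_scalar[OF c(1) pdw bc j]) (use n in simp)
        also have "\<dots> \<le> sqrt (real n * \<kappa>\<^sup>2)"
          using small by (intro real_sqrt_le_mono) simp
        also have "\<dots> = sqrt (real n) * \<kappa>" using \<kappa> by (simp add: real_sqrt_mult)
        finally have "\<bar>((whitener (X \<omega>) * X \<omega>) *\<^sub>v b) $ j - sqrt (real n) * b $ j\<bar> \<le> \<kappa>"
          using n by simp
        moreover have "\<bar>sqrt (real n) * b $ j\<bar> \<le> a" using a[OF j] by (simp add: abs_mult)
        ultimately have "\<bar>z_stat (X \<omega>) (X \<omega> *\<^sub>v b + eps \<omega>) $ j\<bar> \<le> t0"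
          unfolding zj t0_def using noise by linarith
        then show False using z False by simp
      qed
    qed
    then have "prob (R b t) \<le> prob ((F \<union> H) \<union> (\<Union>j<p. N j))"
      using F H N by (intro finite_measure_mono) auto
    also have "\<dots> \<le> prob (F \<union> H) + prob (\<Union>j<p. N j)"
      using F H N by (intro measure_Un_le) auto
    also have "\<dots> \<le> (prob F + prob H) + prob (\<Union>j<p. N j)"
      using F H by (intro add_right_mono measure_Un_le) auto
    also have "\<dots> \<le> 1/2" using F0 close NU by (simp add: H_def)
    finally have "1/2 \<le> 1 - prob (R b t)" by simp
    moreover have "0 \<le> prob (R (0\<^sub>v p) t)" by simp
    ultimately show ?thesis using risk by linarith
  qed
qed

end

section \<open>Concentration of the Gram matrix of a sub-Gaussian design\<close>

text \<open>Induction on I: the sum of the other terms is independent of Y i and both are centred,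
  so the cross term has expectation 0.\<close>

lemma (in prob_space) indep_centered_sum_second_moment:
  fixes Y :: "'i \<Rightarrow> 'a \<Rightarrow> real"
  assumes "finite I" and "indep_vars (\<lambda>_. borel) Y I"
    and "\<And>i. i \<in> I \<Longrightarrow> integrable M (Y i)" and "\<And>i. i \<in> I \<Longrightarrow> expectation (Y i) = 0"
    and "\<And>i. i \<in> I \<Longrightarrow> integrable M (\<lambda>\<omega>. (Y i \<omega>)\<^sup>2)"
  shows "integrable M (\<lambda>\<omega>. (\<Sum>i\<in>I. Y i \<omega>)\<^sup>2)"
    and "expectation (\<lambda>\<omega>. (\<Sum>i\<in>I. Y i \<omega>)\<^sup>2) = (\<Sum>i\<in>I. expectation (\<lambda>\<omega>. (Y i \<omega>)\<^sup>2))"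
proof -
  have "integrable M (\<lambda>\<omega>. (\<Sum>i\<in>I. Y i \<omega>)\<^sup>2) \<and>
    expectation (\<lambda>\<omega>. (\<Sum>i\<in>I. Y i \<omega>)\<^sup>2) = (\<Sum>i\<in>I. expectation (\<lambda>\<omega>. (Y i \<omega>)\<^sup>2))"
    using assms
  proof (induction I rule: finite_induct)
    case empty
    show ?case by simp
  next
    case (insert i I)
    define S where "S = (\<lambda>\<omega>. \<Sum>i\<in>I. Y i \<omega>)"
    have "integrable M (\<lambda>\<omega>. (S \<omega>)\<^sup>2) \<and>
      expectation (\<lambda>\<omega>. (S \<omega>)\<^sup>2) = (\<Sum>i\<in>I. expectation (\<lambda>\<omega>. (Y i \<omega>)\<^sup>2))"
      unfolding S_def
      by (rule insert.IH[OF indep_vars_subset[OF insert.prems(1)]]) (auto intro: insert.prems(2-4))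
    then have IH: "integrable M (\<lambda>\<omega>. (S \<omega>)\<^sup>2)"
      "expectation (\<lambda>\<omega>. (S \<omega>)\<^sup>2) = (\<Sum>i\<in>I. expectation (\<lambda>\<omega>. (Y i \<omega>)\<^sup>2))"
      by blast+
    have S: "integrable M S" "expectation S = 0"
      unfolding S_def using insert.prems(2,3)
      by (auto simp: Bochner_Integration.integral_sum)
    have ind: "indep_var borel (Y i) borel S"
      unfolding S_def by (rule indep_vars_sum[OF insert.hyps insert.prems(1)])
    have Yi: "integrable M (Y i)" "expectation (Y i) = 0" "integrable M (\<lambda>\<omega>. (Y i \<omega>)\<^sup>2)"
      using insert.prems by auto
    have YS: "integrable M (\<lambda>\<omega>. Y i \<omega> * S \<omega>)" "expectation (\<lambda>\<omega>. Y i \<omega> * S \<omega>) = 0"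
      using indep_var_integrable[OF ind Yi(1) S(1)] indep_var_lebesgue_integral[OF ind Yi(1) S(1)] Yi(2)
      by auto
    have eq: "(\<Sum>i\<in>insert i I. Y i \<omega>)\<^sup>2 = (Y i \<omega>)\<^sup>2 + 2 * (Y i \<omega> * S \<omega>) + (S \<omega>)\<^sup>2" for \<omega>
      using insert.hyps by (simp add: S_def power2_sum algebra_simps)
    show ?case
      unfolding eq using Yi YS IH insert.hyps by simp
  qed
  then show "integrable M (\<lambda>\<omega>. (\<Sum>i\<in>I. Y i \<omega>)\<^sup>2)"
    and "expectation (\<lambda>\<omega>. (\<Sum>i\<in>I. Y i \<omega>)\<^sup>2) = (\<Sum>i\<in>I. expectation (\<lambda>\<omega>. (Y i \<omega>)\<^sup>2))"
    by auto
qed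

text \<open>The number x^4 / 24 is a single term of the series of exp |x|, and exp |x| is one of the
  two exponentials.\<close>

lemma power4_le_exp_plus_exp_minus: "x ^ 4 \<le> 24 * (exp x + exp (- x))" for x :: real
proof -
  have pos: "y ^ 4 \<le> 24 * exp y" if "y \<ge> 0" for y :: real
  proof -
    have "(\<Sum>k\<in>{4}. y ^ k /\<^sub>R fact k) \<le> (\<Sum>k. y ^ k /\<^sub>R fact k)"
      by (rule sum_le_suminf[OF summable_exp_generic]) (use that in auto)
    moreover have "(\<Sum>k. y ^ k /\<^sub>R fact k) = exp y" unfolding exp_def ..
    moreover have "fact 4 = (24 :: real)" by (simp add: fact_numeral)
    ultimately have "y ^ 4 / 24 \<le> exp y" by simp
    then show ?thesis by simp
  qed
  have "\<bar>x\<bar> ^ 4 \<le> 24 * exp \<bar>x\<bar>" by (rule pos) simp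
  also have "\<dots> \<le> 24 * (exp x + exp (- x))" by (simp add: abs_if)
  finally show ?thesis by (simp add: power_even_abs)
qed

context
  fixes M :: "'w measure" and X :: "'w \<Rightarrow> real mat" and eps :: "'w \<Rightarrow> real vec" and n p :: nat
    and \<sigma>2 :: real
  assumes model: "model_setup M X eps n p" and subG: "SubG M X n p \<sigma>2"
begin

interpretation prob_space M by (rule model_prob_space[OF model])

text \<open>Only the values t = 1 and t = -1 of the moment generating function are used. The
  constant 48 is the 24 of the exponential series times the two signs.\<close>

lemma SubG_fourth_moment:
  assumes i: "i < n" and u: "(\<Sum>j<p. (u j)\<^sup>2) = 1"
  shows "integrable M (\<lambda>\<omega>. (\<Sum>j<p. u j * X \<omega> $$ (i, j)) ^ 4)"
    and "expectation (\<lambda>\<omega>. (\<Sum>j<p. u j * X \<omega> $$ (i, j)) ^ 4) \<le> 48 * exp (\<sigma>2 / 2)"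
proof -
  define L where "L \<omega> = (\<Sum>j<p. u j * X \<omega> $$ (i, j))" for \<omega>
  have [measurable]: "L \<in> borel_measurable M"
    unfolding L_def using measurable_mat_design[OF model] i
    by (intro borel_measurable_sum borel_measurable_times) (auto simp: measurable_mat_def)
  have mgf: "integrable M (\<lambda>\<omega>. exp (t * L \<omega>))" "ln (expectation (\<lambda>\<omega>. exp (t * L \<omega>))) \<le> \<sigma>2 * t\<^sup>2 / 2" for t
    using subG[unfolded SubG_def, THEN conjunct2, THEN conjunct2, THEN conjunct2, THEN conjunct2,
        THEN conjunct1, rule_format, OF i u, of t]
    unfolding L_def by auto
  have le: "expectation (\<lambda>\<omega>. exp (t * L \<omega>)) \<le> exp (\<sigma>2 / 2)" if "t\<^sup>2 = 1" for t
  \<comment> \<open>The hypothesis bounds a logarithm, which controls the expectation only if that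
    is positive; otherwise the bound is immediate.\<close>
  proof (cases "expectation (\<lambda>\<omega>. exp (t * L \<omega>)) > 0")
    case True
    have "exp (ln (expectation (\<lambda>\<omega>. exp (t * L \<omega>)))) \<le> exp (\<sigma>2 * t\<^sup>2 / 2)"
      unfolding exp_le_cancel_iff by (rule mgf(2))
    then show ?thesis using True that by simp
  next
    case False
    then show ?thesis by (meson exp_ge_zero not_less order_trans)
  qed
  have int: "integrable M (\<lambda>\<omega>. 24 * (exp (L \<omega>) + exp (- L \<omega>)))"
    using mgf(1)[of 1] mgf(1)[of "- 1"] by auto
  have int4: "integrable M (\<lambda>\<omega>. (L \<omega>) ^ 4)"
  proof (rule Bochner_Integration.integrable_bound[OF int])
    show "AE \<omega> in M. norm ((L \<omega>) ^ 4) \<le> norm (24 * (exp (L \<omega>) + exp (- L \<omega>)))"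
    proof (rule AE_I2)
      fix \<omega>
      have "0 \<le> (L \<omega>) ^ 4" by simp
      then show "norm ((L \<omega>) ^ 4) \<le> norm (24 * (exp (L \<omega>) + exp (- L \<omega>)))"
        unfolding real_norm_def using power4_le_exp_plus_exp_minus[of "L \<omega>"] by linarith
    qed
  qed measurable
  then show "integrable M (\<lambda>\<omega>. (\<Sum>j<p. u j * X \<omega> $$ (i, j)) ^ 4)" by (simp add: L_def)
  have "expectation (\<lambda>\<omega>. (L \<omega>) ^ 4) \<le> expectation (\<lambda>\<omega>. 24 * (exp (L \<omega>) + exp (- L \<omega>)))"
    by (rule integral_mono[OF int4 int]) (rule power4_le_exp_plus_exp_minus)
  also have "\<dots> = 24 * (expectation (\<lambda>\<omega>. exp (1 * L \<omega>)) + expectation (\<lambda>\<omega>. exp ((- 1) * L \<omega>)))"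
    using mgf(1)[of 1] mgf(1)[of "- 1"] by simp
  also have "\<dots> \<le> 48 * exp (\<sigma>2 / 2)" using le[of 1] le[of "- 1"] by simp
  finally show "expectation (\<lambda>\<omega>. (\<Sum>j<p. u j * X \<omega> $$ (i, j)) ^ 4) \<le> 48 * exp (\<sigma>2 / 2)"
    by (simp add: L_def)
qed

text \<open>Z is the j-th coordinate of (G - n I) u, a sum of n independent terms, one per row x,
  which are centred by isotropy. Each has second moment at most that of x_j times the form of x
  along u, hence at most the mean of two fourth moments.\<close>

lemma SubG_gram_second_moment:
  assumes u: "(\<Sum>j<p. (u j)\<^sup>2) = 1" and j: "j < p"
  defines "Z \<equiv> \<lambda>\<omega>. \<Sum>i<n. X \<omega> $$ (i, j) * (\<Sum>k<p. u k * X \<omega> $$ (i, k)) - u j"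
  shows "integrable M (\<lambda>\<omega>. (Z \<omega>)\<^sup>2)" "expectation (\<lambda>\<omega>. (Z \<omega>)\<^sup>2) \<le> real n * (48 * exp (\<sigma>2 / 2))"
proof -
  define L where "L i \<omega> = (\<Sum>k<p. u k * X \<omega> $$ (i, k))" for i \<omega>
  define Y where "Y i \<omega> = X \<omega> $$ (i, j) * L i \<omega> - u j" for i \<omega>
  define C where "C = 48 * exp (\<sigma>2 / 2)"
  have entry[measurable]: "(\<lambda>\<omega>. X \<omega> $$ (i, k)) \<in> borel_measurable M" if "i < n" "k < p" for i k
    using measurable_mat_design[OF model] that by (auto simp: measurable_mat_def)
  have L[measurable]: "L i \<in> borel_measurable M" if "i < n" for i
    unfolding L_def using that by (intro borel_measurable_sum borel_measurable_times) auto
  have cov: "integrable M (\<lambda>\<omega>. X \<omega> $$ (i, j) * X \<omega> $$ (i, k))"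
    "expectation (\<lambda>\<omega>. X \<omega> $$ (i, j) * X \<omega> $$ (i, k)) = (if j = k then 1 else 0)"
    if "i < n" "k < p" for i k
    using subG[unfolded SubG_def, THEN conjunct2, THEN conjunct2, THEN conjunct2, THEN conjunct1,
        rule_format, OF that(1) j that(2)] by auto
  have XL: "X \<omega> $$ (i, j) * L i \<omega> = (\<Sum>k<p. u k * (X \<omega> $$ (i, j) * X \<omega> $$ (i, k)))" for i \<omega>
    by (simp add: L_def sum_distrib_left mult_ac)
  have intXL: "integrable M (\<lambda>\<omega>. X \<omega> $$ (i, j) * L i \<omega>)" if "i < n" for i
    unfolding XL using cov(1)[OF that] by (intro Bochner_Integration.integrable_sum) simp
  have EXL: "expectation (\<lambda>\<omega>. X \<omega> $$ (i, j) * L i \<omega>) = u j" if "i < n" for i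
  proof -
    have "expectation (\<lambda>\<omega>. X \<omega> $$ (i, j) * L i \<omega>) = (\<Sum>k<p. u k * (if j = k then 1 else 0))"
      unfolding XL using cov[OF that] by (subst Bochner_Integration.integral_sum) auto
    also have "\<dots> = (\<Sum>k<p. if j = k then u k else 0)" by (intro sum.cong) auto
    finally show ?thesis using j by simp
  qed
  have Y: "integrable M (Y i)" "expectation (Y i) = 0" if "i < n" for i
    unfolding Y_def using intXL[OF that] EXL[OF that] by (simp_all add: prob_space)
  have Y2: "integrable M (\<lambda>\<omega>. (Y i \<omega>)\<^sup>2)" "expectation (\<lambda>\<omega>. (Y i \<omega>)\<^sup>2) \<le> C" if i: "i < n" for i
  proof -
    have L4: "integrable M (\<lambda>\<omega>. (L i \<omega>) ^ 4)" "expectation (\<lambda>\<omega>. (L i \<omega>) ^ 4) \<le> C"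
      unfolding L_def C_def by (rule SubG_fourth_moment[OF i u])+
    have X4: "integrable M (\<lambda>\<omega>. (X \<omega> $$ (i, j)) ^ 4)" "expectation (\<lambda>\<omega>. (X \<omega> $$ (i, j)) ^ 4) \<le> C"
    proof -
      \<comment> \<open>A single entry is the linear form along the j-th unit vector, so the bound
        for linear forms covers it too.\<close>
      define e where "e k = (if k = j then 1 else 0 :: real)" for k
      have "(\<Sum>k<p. (e k)\<^sup>2) = (\<Sum>k<p. if k = j then 1 else 0)"
        by (intro sum.cong) (auto simp: e_def)
      then have e: "(\<Sum>k<p. (e k)\<^sup>2) = 1" using j by simp
      have "(\<Sum>k<p. e k * X \<omega> $$ (i, k)) = X \<omega> $$ (i, j)" for \<omega>
      proof -
        have "(\<Sum>k<p. e k * X \<omega> $$ (i, k)) = (\<Sum>k<p. if k = j then X \<omega> $$ (i, k) else 0)"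
          by (intro sum.cong) (auto simp: e_def)
        then show ?thesis using j by simp
      qed
      then show "integrable M (\<lambda>\<omega>. (X \<omega> $$ (i, j)) ^ 4)" "expectation (\<lambda>\<omega>. (X \<omega> $$ (i, j)) ^ 4) \<le> C"
        using SubG_fourth_moment[OF i e] by (simp_all add: C_def)
    qed
    have amgm: "(x * y)\<^sup>2 \<le> (x ^ 4 + y ^ 4) / 2" for x y :: real
      using sum_squares_bound[of "x\<^sup>2" "y\<^sup>2"] by (simp add: power_mult_distrib flip: power_mult)
    have int: "integrable M (\<lambda>\<omega>. ((X \<omega> $$ (i, j)) ^ 4 + (L i \<omega>) ^ 4) / 2)"
      using X4(1) L4(1) by simp
    have int2: "integrable M (\<lambda>\<omega>. (X \<omega> $$ (i, j) * L i \<omega>)\<^sup>2)"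
    proof (rule Bochner_Integration.integrable_bound[OF int])
      show "(\<lambda>\<omega>. (X \<omega> $$ (i, j) * L i \<omega>)\<^sup>2) \<in> borel_measurable M"
        using entry[OF i j] L[OF i] by measurable
      show "AE \<omega> in M. norm ((X \<omega> $$ (i, j) * L i \<omega>)\<^sup>2) \<le> norm (((X \<omega> $$ (i, j)) ^ 4 + (L i \<omega>) ^ 4) / 2)"
      proof (rule AE_I2)
        fix \<omega>
        have "0 \<le> (X \<omega> $$ (i, j) * L i \<omega>)\<^sup>2" by simp
        then show "norm ((X \<omega> $$ (i, j) * L i \<omega>)\<^sup>2) \<le> norm (((X \<omega> $$ (i, j)) ^ 4 + (L i \<omega>) ^ 4) / 2)"
          unfolding real_norm_def using amgm[of "X \<omega> $$ (i, j)" "L i \<omega>"] by linarith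
      qed
    qed
    have "expectation (\<lambda>\<omega>. (X \<omega> $$ (i, j) * L i \<omega>)\<^sup>2)
        \<le> expectation (\<lambda>\<omega>. ((X \<omega> $$ (i, j)) ^ 4 + (L i \<omega>) ^ 4) / 2)"
      by (rule integral_mono[OF int2 int]) (rule amgm)
    also have "\<dots> \<le> C" using X4 L4 by simp
    finally have E2: "expectation (\<lambda>\<omega>. (X \<omega> $$ (i, j) * L i \<omega>)\<^sup>2) \<le> C" .
    have eq: "(Y i \<omega>)\<^sup>2 = (X \<omega> $$ (i, j) * L i \<omega>)\<^sup>2 - 2 * u j * (X \<omega> $$ (i, j) * L i \<omega>) + (u j)\<^sup>2" for \<omega>
      by (simp add: Y_def power2_diff)
    show "integrable M (\<lambda>\<omega>. (Y i \<omega>)\<^sup>2)" unfolding eq using int2 intXL[OF i] by simp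
    have "expectation (\<lambda>\<omega>. (Y i \<omega>)\<^sup>2) = expectation (\<lambda>\<omega>. (X \<omega> $$ (i, j) * L i \<omega>)\<^sup>2) - (u j)\<^sup>2"
      unfolding eq using int2 intXL[OF i] EXL[OF i]
      by (simp add: prob_space power2_eq_square)
    then show "expectation (\<lambda>\<omega>. (Y i \<omega>)\<^sup>2) \<le> C" using E2 zero_le_power2[of "u j"] by linarith
  qed
  have "indep_vars (\<lambda>_. PiM {..<p} (\<lambda>_. borel)) (row_rv X p) {..<n}"
    using subG by (simp add: SubG_def)
  then have "indep_vars (\<lambda>_. borel) (\<lambda>i \<omega>. (\<lambda>f. f j * (\<Sum>k<p. u k * f k) - u j) (row_rv X p i \<omega>)) {..<n}"
  proof (rule indep_vars_compose2)
    show "(\<lambda>f. f j * (\<Sum>k<p. u k * f k) - u j) \<in> borel_measurable (PiM {..<p} (\<lambda>_. borel))" for i :: nat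
      using j by (intro borel_measurable_diff borel_measurable_times borel_measurable_sum
        borel_measurable_const measurable_component_singleton) auto
  qed
  then have indep: "indep_vars (\<lambda>_. borel) Y {..<n}"
    using j by (simp add: Y_def[abs_def] L_def row_rv_def)
  have Z: "Z = (\<lambda>\<omega>. \<Sum>i<n. Y i \<omega>)" by (simp add: Z_def Y_def L_def)
  note sm = indep_centered_sum_second_moment[OF _ indep Y Y2(1), simplified]
  show "integrable M (\<lambda>\<omega>. (Z \<omega>)\<^sup>2)" unfolding Z by (rule sm(1))
  have "expectation (\<lambda>\<omega>. (Z \<omega>)\<^sup>2) = (\<Sum>i<n. expectation (\<lambda>\<omega>. (Y i \<omega>)\<^sup>2))" unfolding Z by (rule sm(2))
  also have "\<dots> \<le> (\<Sum>i<n. C)" by (intro sum_mono Y2(2)) simp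
  finally show "expectation (\<lambda>\<omega>. (Z \<omega>)\<^sup>2) \<le> real n * (48 * exp (\<sigma>2 / 2))" by (simp add: C_def)
qed

text \<open>Rescale b to a unit vector, add the second moments over p coordinates to obtain at most
  B * p * n times the constant, and apply Markov's inequality. The factor n cancels against n *
  \<kappa>^2.\<close>

lemma SubG_gram_concentration:
  assumes b: "b \<in> carrier_vec p" and B: "(\<Sum>j<p. (b $ j)\<^sup>2) = B" "B > 0" and n: "n > 0" and \<kappa>: "\<kappa> > 0"
  shows "prob {\<omega> \<in> space M. real n * \<kappa>\<^sup>2 <
        (\<Sum>j<p. (((transpose_mat (X \<omega>) * X \<omega>) *\<^sub>v b) $ j - real n * b $ j)\<^sup>2)}
     \<le> 48 * exp (\<sigma>2 / 2) * real p * B / \<kappa>\<^sup>2"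
proof -
  define u where "u j = b $ j / sqrt B" for j
  have u: "(\<Sum>j<p. (u j)\<^sup>2) = 1"
    using B by (simp add: u_def power_divide sum_divide_distrib[symmetric])
  define Z where "Z j \<omega> = (\<Sum>i<n. X \<omega> $$ (i, j) * (\<Sum>k<p. u k * X \<omega> $$ (i, k)) - u j)" for j \<omega>
  note Z = SubG_gram_second_moment[OF u, folded Z_def]
  have eq: "(\<Sum>j<p. (((transpose_mat (X \<omega>) * X \<omega>) *\<^sub>v b) $ j - real n * b $ j)\<^sup>2) = B * (\<Sum>j<p. (Z j \<omega>)\<^sup>2)"
    if "\<omega> \<in> space M" for \<omega>
    unfolding sum_distrib_left
  proof (rule sum.cong)
    fix j assume "j \<in> {..<p}"
    then have j: "j < p" by simp
    have Xc: "X \<omega> \<in> carrier_mat n p" by (rule model_carrier[OF model that])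
    have bu: "b $ k = sqrt B * u k" for k using B by (simp add: u_def)
    have "(transpose_mat (X \<omega>) * X \<omega>) *\<^sub>v b = transpose_mat (X \<omega>) *\<^sub>v (X \<omega> *\<^sub>v b)"
      using Xc b by (intro assoc_mult_mat_vec) auto
    then have "((transpose_mat (X \<omega>) * X \<omega>) *\<^sub>v b) $ j = (\<Sum>i<n. X \<omega> $$ (i, j) * (\<Sum>k<p. X \<omega> $$ (i, k) * b $ k))"
      using Xc b j by (simp add: scalar_prod_def atLeast0LessThan)
    also have "\<dots> = sqrt B * (\<Sum>i<n. X \<omega> $$ (i, j) * (\<Sum>k<p. u k * X \<omega> $$ (i, k)))"
      unfolding bu by (simp add: sum_distrib_left mult_ac)
    finally have "((transpose_mat (X \<omega>) * X \<omega>) *\<^sub>v b) $ j - real n * b $ j = sqrt B * Z j \<omega>"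
      unfolding bu Z_def by (simp add: sum_subtractf algebra_simps)
    then show "(((transpose_mat (X \<omega>) * X \<omega>) *\<^sub>v b) $ j - real n * b $ j)\<^sup>2 = B * (Z j \<omega>)\<^sup>2"
      using B by (simp add: power_mult_distrib)
  qed simp
  have int: "integrable M (\<lambda>\<omega>. B * (\<Sum>j<p. (Z j \<omega>)\<^sup>2))"
    using Z(1) by (intro integrable_mult_right Bochner_Integration.integrable_sum) auto
  have "prob {\<omega> \<in> space M. real n * \<kappa>\<^sup>2 <
        (\<Sum>j<p. (((transpose_mat (X \<omega>) * X \<omega>) *\<^sub>v b) $ j - real n * b $ j)\<^sup>2)}
      = prob {\<omega> \<in> space M. real n * \<kappa>\<^sup>2 < B * (\<Sum>j<p. (Z j \<omega>)\<^sup>2)}"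
    using eq by (intro arg_cong[of _ _ prob]) auto
  also have "\<dots> \<le> prob {\<omega> \<in> space M. B * (\<Sum>j<p. (Z j \<omega>)\<^sup>2) \<ge> real n * \<kappa>\<^sup>2}"
    using int by (intro finite_measure_mono) (auto, measurable)
  also have "\<dots> \<le> expectation (\<lambda>\<omega>. B * (\<Sum>j<p. (Z j \<omega>)\<^sup>2)) / (real n * \<kappa>\<^sup>2)"
    using n \<kappa> B(2) by (intro integral_Markov_inequality_measure[OF int, of "space M"]) (auto intro!: AE_I2 mult_nonneg_nonneg sum_nonneg)
  also have "\<dots> \<le> (B * (real p * (real n * (48 * exp (\<sigma>2 / 2))))) / (real n * \<kappa>\<^sup>2)"
  proof (intro divide_right_mono)
    have "expectation (\<lambda>\<omega>. B * (\<Sum>j<p. (Z j \<omega>)\<^sup>2)) = B * (\<Sum>j<p. expectation (\<lambda>\<omega>. (Z j \<omega>)\<^sup>2))"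
      using Z(1) by (simp add: Bochner_Integration.integral_sum)
    also have "\<dots> \<le> B * (\<Sum>j<p. real n * (48 * exp (\<sigma>2 / 2)))"
      using Z(2) B(2) by (intro mult_left_mono sum_mono) auto
    finally show "expectation (\<lambda>\<omega>. B * (\<Sum>j<p. (Z j \<omega>)\<^sup>2)) \<le> B * (real p * (real n * (48 * exp (\<sigma>2 / 2))))"
      by simp
  qed simp
  also have "\<dots> = 48 * exp (\<sigma>2 / 2) * real p * B / \<kappa>\<^sup>2" using n by simp
  finally show ?thesis .
qed

end

section \<open>Asymptotics of the risk\<close>

text \<open>The witness for the type II error: its nonzero entries all have the smallest size that
  \<open>Xi\<close> permits, which keeps the signal part of max_j |z_j| low.\<close>

lemma sparse_vec_Xi:
  fixes A :: real
  assumes "s \<le> p" and "A > 0"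
  defines "b \<equiv> vec p (\<lambda>i. if i < s then A else 0)"
  shows "b \<in> carrier_vec p" "b \<in> Xi p s A" "(\<Sum>j<p. (b $ j)\<^sup>2) = real s * A\<^sup>2"
    "\<And>j. j < p \<Longrightarrow> \<bar>b $ j\<bar> \<le> A"
proof -
  show "b \<in> carrier_vec p" by (simp add: b_def)
  have "{i. i < p \<and> b $ i \<noteq> 0} = {..<s}"
    using assms by (auto simp: b_def split: if_splits)
  then show "b \<in> Xi p s A" using assms by (auto simp: Xi_def b_def)
  have "(\<Sum>j<p. (b $ j)\<^sup>2) = (\<Sum>j<s. A\<^sup>2)"
    using assms by (intro sum.mono_neutral_cong_right) (auto simp: b_def)
  then show "(\<Sum>j<p. (b $ j)\<^sup>2) = real s * A\<^sup>2" by simp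
  show "\<And>j. j < p \<Longrightarrow> \<bar>b $ j\<bar> \<le> A" using assms by (simp add: b_def)
qed

text \<open>The general bound with a = sqrt (2 r ln p), which is sqrt n * A, with \<kappa> =
  \<delta> * sqrt (2 r s ln p) and u = 2 * sqrt (ln p). It is uniform in t and positive, so it
  passes to the infimum and then through \<open>ln\<close>.\<close>

lemma ln_INF_Risk_lower_bound:
  assumes model: "model_setup M X eps n p"
    and pd: "AE \<omega> in M. posdef_mat (transpose_mat (X \<omega>) * X \<omega>)"
    and p: "8 \<le> p" and n: "0 < n" and s: "s \<le> p" and r: "0 < r" and \<delta>: "0 < \<delta>"
    and close: "measure M {\<omega> \<in> space M. real n * (\<delta> * sqrt (2 * r * real s * ln (real p)))\<^sup>2 <
        (\<Sum>i<p. (((transpose_mat (X \<omega>) * X \<omega>) *\<^sub>v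
          vec p (\<lambda>i. if i < s then sqrt (2 * r * ln (real p) / real n) else 0)) $ i
          - real n * vec p (\<lambda>i. if i < s then sqrt (2 * r * ln (real p) / real n) else 0) $ i)\<^sup>2)} \<le> 1/4"
  shows "- ((sqrt (2 * r * ln (real p)) + \<delta> * sqrt (2 * r * real s * ln (real p))
        + 2 * sqrt (ln (real p)) + 1)\<^sup>2 / 2 + ln 8)
    \<le> ln (INF t. Risk M X eps p (xi_test t) s (sqrt (2 * r * ln (real p) / real n)))"
proof -
  define A where "A = sqrt (2 * r * ln (real p) / real n)"
  define T where "T = sqrt (2 * r * ln (real p)) + \<delta> * sqrt (2 * r * real s * ln (real p))
        + 2 * sqrt (ln (real p)) + 1"
  have l: "ln (real p) > 0" using p by simp
  have A: "A > 0" using l r n by (simp add: A_def)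
  have "exp (- T\<^sup>2 / 2) \<le> 1" by simp
  then have e1: "exp (- T\<^sup>2 / 2) / 8 \<le> 1/2" by linarith
  \<comment> \<open>The factor 1/8 serves twice, through sqrt (2 * pi) <= 8 and through 1/8 <= 1/2.
    It costs only the additive term ln 8.\<close>
  have "sqrt (2 * pi) \<le> sqrt (8\<^sup>2)" using pi_less_4 by (intro real_sqrt_le_mono) simp
  then have "exp (- T\<^sup>2 / 2) / 8 \<le> std_normal_density T"
    by (simp add: std_normal_density_def field_simps)
  then have e2: "exp (- T\<^sup>2 / 2) / 8 \<le> min (std_normal_density T) (1/2)"
    using e1 by simp
  have "exp (- T\<^sup>2 / 2) / 8 \<le> Risk M X eps p (xi_test t) s A" for t
  proof -
    have "min (std_normal_density (sqrt (2 * r * ln (real p)) + \<delta> * sqrt (2 * r * real s * ln (real p))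
        + 2 * sqrt (ln (real p)) + 1)) (1/2) \<le> Risk M X eps p (xi_test t) s A"
    proof (rule Risk_lower_bound[OF model pd _ n sparse_vec_Xi(2)[OF s A]])
      show "measure M {\<omega> \<in> space M. real n * (\<delta> * sqrt (2 * r * real s * ln (real p)))\<^sup>2 <
          (\<Sum>i<p. (((transpose_mat (X \<omega>) * X \<omega>) *\<^sub>v vec p (\<lambda>i. if i < s then A else 0)) $ i
          - real n * vec p (\<lambda>i. if i < s then A else 0) $ i)\<^sup>2)} \<le> 1/4"
        using close by (simp only: A_def)
      \<comment> \<open>This choice of u turns the union bound for the noise into 2 p / p^2 = 2 / p,
        which is at most 1/4 from p = 8 on.\<close>
      have "(2 * sqrt (ln (real p)))\<^sup>2 / 2 = 2 * ln (real p)"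
        using l by (simp add: power_mult_distrib)
      then have eq: "exp (- (2 * sqrt (ln (real p)))\<^sup>2 / 2) = 1 / (real p)\<^sup>2"
        using p by (simp add: exp_minus exp_double inverse_eq_divide)
      then show "2 * real p * exp (- (2 * sqrt (ln (real p)))\<^sup>2 / 2) \<le> 1/4"
        unfolding eq using p by (simp add: power2_eq_square field_simps)
      fix j assume "j < p"
      then have "sqrt (real n) * \<bar>vec p (\<lambda>i. if i < s then A else 0) $ j\<bar> \<le> sqrt (real n) * A"
        by (intro mult_left_mono sparse_vec_Xi(4)[OF s A]) auto
      also have "\<dots> = sqrt (2 * r * ln (real p))"
        using n by (simp add: A_def real_sqrt_mult[symmetric])
      finally show "sqrt (real n) * \<bar>vec p (\<lambda>i. if i < s then A else 0) $ j\<bar> \<le> sqrt (2 * r * ln (real p))" .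
    qed (use p l r \<delta> in auto)
    then show ?thesis using e2 unfolding T_def by linarith
  qed
  then have "exp (- T\<^sup>2 / 2) / 8 \<le> (INF t. Risk M X eps p (xi_test t) s A)"
    by (intro cINF_greatest) auto
  then have "ln (exp (- T\<^sup>2 / 2) / 8) \<le> ln (INF t. Risk M X eps p (xi_test t) s A)"
    by (intro ln_mono) auto
  also have "ln (exp (- T\<^sup>2 / 2) / 8) = - (T\<^sup>2 / 2 + ln 8)"
    by (simp add: ln_div)
  finally show ?thesis by (simp add: T_def A_def)
qed

text \<open>Divided by sqrt (S l), the threshold is \<delta> * sqrt (2 r) plus vanishing terms. Only
  the allowance for the matrix error has full order, and half of its square is \<delta>^2 r.\<close>

lemma exponent_tendsto:
  fixes S l :: "nat \<Rightarrow> real" and r \<delta> :: real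
  assumes S: "filterlim S at_top sequentially" and l: "filterlim l at_top sequentially"
    and r: "r > 0"
  shows "(\<lambda>p. - ((sqrt (2 * r * l p) + \<delta> * sqrt (2 * r * S p * l p) + 2 * sqrt (l p) + 1)\<^sup>2 / 2 + ln 8)
      / (S p * l p)) \<longlonglongrightarrow> - (\<delta>\<^sup>2 * r)"
proof -
  have iS: "(\<lambda>p. inverse (sqrt (S p))) \<longlonglongrightarrow> 0" and il: "(\<lambda>p. inverse (sqrt (l p))) \<longlonglongrightarrow> 0"
    using filterlim_compose[OF sqrt_at_top S] filterlim_compose[OF sqrt_at_top l]
    by (auto intro: tendsto_inverse_0_at_top)
  \<comment> \<open>The exponent up to sign, rewritten in the null sequences 1 / sqrt S and 1 / sqrt
    l. The coefficient sqrt (2 * r) + 2 collects the signal level and the noise level.\<close>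
  define f where "f p = ((sqrt (2 * r) + 2) * inverse (sqrt (S p)) + \<delta> * sqrt (2 * r)
      + inverse (sqrt (S p)) * inverse (sqrt (l p)))\<^sup>2 / 2
      + ln 8 * (inverse (sqrt (S p)) * inverse (sqrt (l p)))\<^sup>2" for p
  have "(\<lambda>p. - f p) \<longlonglongrightarrow> - (((sqrt (2 * r) + 2) * 0 + \<delta> * sqrt (2 * r) + 0 * 0)\<^sup>2 / 2 + ln 8 * (0 * 0)\<^sup>2)"
    unfolding f_def by (intro tendsto_intros iS il) auto
  also have "- (((sqrt (2 * r) + 2) * 0 + \<delta> * sqrt (2 * r) + 0 * 0)\<^sup>2 / 2 + ln 8 * (0 * 0)\<^sup>2) = - (\<delta>\<^sup>2 * r)"
    using r by (simp add: power_mult_distrib)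
  finally have lim: "(\<lambda>p. - f p) \<longlonglongrightarrow> - (\<delta>\<^sup>2 * r)" .
  have ev: "\<forall>\<^sub>F p in sequentially. - f p = - ((sqrt (2 * r * l p) + \<delta> * sqrt (2 * r * S p * l p)
      + 2 * sqrt (l p) + 1)\<^sup>2 / 2 + ln 8) / (S p * l p)"
    using S[unfolded filterlim_at_top_dense, rule_format, of 0] l[unfolded filterlim_at_top_dense, rule_format, of 0]
  proof eventually_elim
    fix p assume pos: "0 < S p" "0 < l p"
    define x where "x = sqrt (S p)"
    define y where "y = sqrt (l p)"
    have xy: "x > 0" "y > 0" "S p = x\<^sup>2" "l p = y\<^sup>2" using pos by (auto simp: x_def y_def)
    show "- f p = - ((sqrt (2 * r * l p) + \<delta> * sqrt (2 * r * S p * l p)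
      + 2 * sqrt (l p) + 1)\<^sup>2 / 2 + ln 8) / (S p * l p)"
    proof -
      define \<rho> where "\<rho> = sqrt (2 * r)"
      have "sqrt (2 * r * y\<^sup>2) = \<rho> * y" "sqrt (2 * r * x\<^sup>2 * y\<^sup>2) = \<rho> * x * y" "sqrt (x\<^sup>2) = x" "sqrt (y\<^sup>2) = y"
        using xy(1,2) by (auto simp: \<rho>_def real_sqrt_mult)
      then show ?thesis
        using xy(1,2) unfolding f_def xy(3,4) \<rho>_def[symmetric]
        by (simp add: power2_eq_square field_simps)
    qed
  qed
  show ?thesis by (rule Lim_transform_eventually[OF lim ev])
qed

lemma filterlim_sparsity:
  assumes "\<alpha> < 1"
  shows "filterlim (\<lambda>p. real (nat \<lfloor>real p powr (1 - \<alpha>)\<rfloor>)) at_top sequentially"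
proof -
  have "filterlim (\<lambda>p. real p powr (1 - \<alpha>) - 1) at_top sequentially"
    using assms by real_asymp
  then show ?thesis
    by (rule filterlim_at_top_mono) (intro always_eventually allI, linarith)
qed

lemma sparsity_le:
  assumes "0 \<le> \<alpha>" "1 \<le> p"
  shows "nat \<lfloor>real p powr (1 - \<alpha>)\<rfloor> \<le> p"
proof -
  have "real p powr (1 - \<alpha>) \<le> real p powr 1" using assms by (intro powr_mono) auto
  then have "real p powr (1 - \<alpha>) \<le> real p" using assms by simp
  then show ?thesis by linarith
qed

theorem mainTheorem11:
  fixes \<alpha> r \<sigma>2 :: real
    and n :: "nat \<Rightarrow> nat"
    and M :: "nat \<Rightarrow> 'w measure"
    and X :: "nat \<Rightarrow> 'w \<Rightarrow> real mat"
    and eps :: "nat \<Rightarrow> 'w \<Rightarrow> real vec"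
  assumes "1/2 < \<alpha>" and "\<alpha> < 1" and "r > \<alpha>"
    and "filterlim n at_top sequentially"
    and "\<forall>p. model_setup (M p) (X p) (eps p) (n p) p"
    and "((\<forall>p. SubG (M p) (X p) (n p) p \<sigma>2) \<and>
            filterlim (\<lambda>p. real (n p) / real p powr (3/2)) at_top sequentially)
         \<or> (\<forall>p. Orth_design (M p) (X p) (n p) p \<and> n p \<ge> p)"
  shows "liminf (\<lambda>p. ereal
           (ln (INF t::real. Risk (M p) (X p) (eps p) p (xi_test t)
                   (nat \<lfloor>real p powr (1 - \<alpha>)\<rfloor>) (sqrt (2 * r * ln (real p) / real (n p))))
            / (real (nat \<lfloor>real p powr (1 - \<alpha>)\<rfloor>) * ln (real p))))
         > ereal (- (r - \<alpha>)\<^sup>2 / (4 * r))"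
proof -
  define s where "s p = nat \<lfloor>real p powr (1 - \<alpha>)\<rfloor>" for p
  define A where "A p = sqrt (2 * r * ln (real p) / real (n p))" for p
  define b where "b p = vec p (\<lambda>i. if i < s p then A p else 0)" for p
  \<comment> \<open>With this value \<delta>^2 r = (r - \<alpha>)^2 / (16 r), a quarter of the rate
    in the theorem, which yields the strict inequality. It is positive because r > \<alpha>.\<close>
  define \<delta> where "\<delta> = (r - \<alpha>) / (4 * r)"
  define \<kappa> where "\<kappa> p = \<delta> * sqrt (2 * r * real (s p) * ln (real p))" for p
  define G where "G p \<omega> = transpose_mat (X p \<omega>) * X p \<omega>" for p \<omega>
  have r: "r > 0" and \<delta>: "\<delta> > 0" using assms by (auto simp: \<delta>_def)
  have model: "model_setup (M p) (X p) (eps p) (n p) p" for p using assms(5) by blast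
  have s_lim: "filterlim (\<lambda>p. real (s p)) at_top sequentially"
    unfolding s_def by (rule filterlim_sparsity[OF assms(2)])
  have ln_lim: "filterlim (\<lambda>p. ln (real p)) at_top sequentially" by real_asymp
  have ev_n: "\<forall>\<^sub>F p in sequentially. 0 < n p"
    using assms(4)[unfolded filterlim_at_top, rule_format, of 1] by eventually_elim simp
  have ev_s: "\<forall>\<^sub>F p in sequentially. 0 < real (s p)"
    by (rule s_lim[unfolded filterlim_at_top_dense, rule_format])
  \<comment> \<open>The two design classes differ only up to this point: almost sure positive
    definiteness, and concentration of G at the single vector b p, are all that is passed
    on.\<close>
  have ev_design: "\<forall>\<^sub>F p in sequentially. (AE \<omega> in M p. posdef_mat (G p \<omega>)) \<and>
      measure (M p) {\<omega> \<in> space (M p). real (n p) * (\<kappa> p)\<^sup>2 <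
        (\<Sum>i<p. ((G p \<omega> *\<^sub>v b p) $ i - real (n p) * b p $ i)\<^sup>2)} \<le> 1/4"
    using assms(6)
  proof (elim disjE conjE)
    assume subG: "\<forall>p. SubG (M p) (X p) (n p) p \<sigma>2"
      and growth: "filterlim (\<lambda>p. real (n p) / real p powr (3/2)) at_top sequentially"
    \<comment> \<open>Since s A^2 / \<kappa>^2 = 1 / (\<delta>^2 n), the Markov bound equals C p /
      (4 n), which is at most 1/4 once n >= C p.\<close>
    define C where "C = 4 * (48 * exp (\<sigma>2 / 2)) / \<delta>\<^sup>2"
    have "\<forall>\<^sub>F p in sequentially. C \<le> real (n p) / real p powr (3/2)"
      using growth by (simp add: filterlim_at_top)
    with ev_n ev_s eventually_ge_at_top[of 8] show ?thesis
    proof eventually_elim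
      fix p assume n: "0 < n p" and s: "0 < real (s p)" and p: "8 \<le> p"
        and C: "C \<le> real (n p) / real p powr (3/2)"
      have l: "ln (real p) > 0" using p by simp
      have sp: "s p \<le> p" unfolding s_def using assms(1) p by (intro sparsity_le) auto
      have A: "A p > 0" using l r n by (simp add: A_def)
      have A2: "(A p)\<^sup>2 = 2 * r * ln (real p) / real (n p)"
        using l r n by (simp add: A_def)
      have \<kappa>2: "(\<kappa> p)\<^sup>2 = \<delta>\<^sup>2 * (2 * r * real (s p) * ln (real p))"
        using r l by (simp add: \<kappa>_def power_mult_distrib)
      \<comment> \<open>The growth condition gives n >= C * p^(3/2) eventually, and this dominates C
        * p.\<close>
      have "real p powr 1 \<le> real p powr (3/2)" using p by (intro powr_mono) auto
      then have pp: "real p \<le> real p powr (3/2)" using p by simp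
      have C0: "C > 0" using \<delta> by (simp add: C_def)
      have "C * real p \<le> C * real p powr (3/2)" using pp C0 by (simp add: mult_left_mono)
      also have "\<dots> \<le> real (n p)" using C p by (simp add: field_simps)
      finally have Cp: "C * real p \<le> real (n p)" .
      have pd: "AE \<omega> in M p. posdef_mat (G p \<omega>)"
        using subG unfolding SubG_def G_def by blast
      have "measure (M p) {\<omega> \<in> space (M p). real (n p) * (\<kappa> p)\<^sup>2 <
        (\<Sum>i<p. ((G p \<omega> *\<^sub>v b p) $ i - real (n p) * b p $ i)\<^sup>2)}
        \<le> 48 * exp (\<sigma>2 / 2) * real p * (real (s p) * (A p)\<^sup>2) / (\<kappa> p)\<^sup>2"
        unfolding G_def b_def
        by (rule SubG_gram_concentration[OF model subG[rule_format] sparse_vec_Xi(1)[OF sp A]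
            sparse_vec_Xi(3)[OF sp A] _ n])
          (use s A l r \<delta> in \<open>auto simp: \<kappa>_def\<close>)
      also have "48 * exp (\<sigma>2 / 2) * real p * (real (s p) * (A p)\<^sup>2) / (\<kappa> p)\<^sup>2
          = (C * real p) / (4 * real (n p))"
        unfolding A2 \<kappa>2 C_def using s r l n \<delta> by (simp add: field_simps)
      also have "\<dots> \<le> 1/4" using Cp n by (simp add: field_simps)
      finally show "(AE \<omega> in M p. posdef_mat (G p \<omega>)) \<and>
        measure (M p) {\<omega> \<in> space (M p). real (n p) * (\<kappa> p)\<^sup>2 <
        (\<Sum>i<p. ((G p \<omega> *\<^sub>v b p) $ i - real (n p) * b p $ i)\<^sup>2)} \<le> 1/4"
        using pd by blast
    qed
  next
    assume orth: "\<forall>p. Orth_design (M p) (X p) (n p) p \<and> n p \<ge> p"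
    show ?thesis
      using ev_n
    proof eventually_elim
      fix p assume n: "0 < n p"
      have G: "G p \<omega> = real (n p) \<cdot>\<^sub>m 1\<^sub>m p" if "\<omega> \<in> space (M p)" for \<omega>
        using orth that unfolding Orth_design_def G_def by blast
      have Gv: "(real (n p) \<cdot>\<^sub>m 1\<^sub>m p) *\<^sub>v v = real (n p) \<cdot>\<^sub>v v" if "v \<in> carrier_vec p" for v
        using that by (intro eq_vecI) auto
      have "posdef_mat (real (n p) \<cdot>\<^sub>m 1\<^sub>m p)"
        unfolding posdef_mat_def
      proof (intro exI[of _ p] conjI ballI impI)
        fix v :: "real vec" assume "v \<in> carrier_vec p" "v \<noteq> 0\<^sub>v p"
        then show "0 < v \<bullet> ((real (n p) \<cdot>\<^sub>m 1\<^sub>m p) *\<^sub>v v)"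
          using Gv[of v] scalar_prod_self_pos[of v p] n by simp
      qed (auto intro!: eq_matI)
      then have pd: "AE \<omega> in M p. posdef_mat (G p \<omega>)" using G by (intro AE_I2) simp
      \<comment> \<open>For an orthogonal design G = n I, so G b - n b vanishes identically and the
        deviation event cannot occur.\<close>
      have empty: "{\<omega> \<in> space (M p). real (n p) * (\<kappa> p)\<^sup>2 <
        (\<Sum>i<p. ((G p \<omega> *\<^sub>v b p) $ i - real (n p) * b p $ i)\<^sup>2)} = {}"
      proof -
        have "(\<Sum>i<p. ((G p \<omega> *\<^sub>v b p) $ i - real (n p) * b p $ i)\<^sup>2) = 0" if "\<omega> \<in> space (M p)" for \<omega>
          unfolding G[OF that] using Gv[of "b p"] by (simp add: b_def)
        then show ?thesis by (auto simp: not_less)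
      qed
      show "(AE \<omega> in M p. posdef_mat (G p \<omega>)) \<and>
        measure (M p) {\<omega> \<in> space (M p). real (n p) * (\<kappa> p)\<^sup>2 <
        (\<Sum>i<p. ((G p \<omega> *\<^sub>v b p) $ i - real (n p) * b p $ i)\<^sup>2)} \<le> 1/4"
        unfolding empty using pd by simp
    qed
  qed
  define q where "q p = - ((sqrt (2 * r * ln (real p)) + \<delta> * sqrt (2 * r * real (s p) * ln (real p))
        + 2 * sqrt (ln (real p)) + 1)\<^sup>2 / 2 + ln 8) / (real (s p) * ln (real p))" for p
  define h where "h p = ln (INF t. Risk (M p) (X p) (eps p) p (xi_test t) (s p) (A p))
      / (real (s p) * ln (real p))" for p
  have ev: "\<forall>\<^sub>F p in sequentially. ereal (q p) \<le> ereal (h p)"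
    using ev_n ev_s eventually_ge_at_top[of 8] ev_design
  proof eventually_elim
    fix p assume n: "0 < n p" and s: "0 < real (s p)" and p: "8 \<le> p"
      and design: "(AE \<omega> in M p. posdef_mat (G p \<omega>)) \<and>
        measure (M p) {\<omega> \<in> space (M p). real (n p) * (\<kappa> p)\<^sup>2 <
        (\<Sum>i<p. ((G p \<omega> *\<^sub>v b p) $ i - real (n p) * b p $ i)\<^sup>2)} \<le> 1/4"
    have sp: "s p \<le> p" unfolding s_def using assms(1) p by (intro sparsity_le) auto
    show "ereal (q p) \<le> ereal (h p)"
      unfolding q_def h_def A_def ereal_less_eq
      using ln_INF_Risk_lower_bound[OF model design[THEN conjunct1, unfolded G_def] p n sp r \<delta>
          design[THEN conjunct2, unfolded G_def b_def A_def \<kappa>_def]] s p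
      by (intro divide_right_mono) auto
  qed
  have "(\<lambda>p. ereal (q p)) \<longlonglongrightarrow> ereal (- (\<delta>\<^sup>2 * r))"
    unfolding q_def using exponent_tendsto[OF s_lim ln_lim r] by simp
  then have "ereal (- (\<delta>\<^sup>2 * r)) = liminf (\<lambda>p. ereal (q p))"
    by (intro lim_imp_Liminf[symmetric]) auto
  also have "\<dots> \<le> liminf (\<lambda>p. ereal (h p))"
    by (rule Liminf_mono[OF ev])
  finally have "ereal (- (\<delta>\<^sup>2 * r)) \<le> liminf (\<lambda>p. ereal (h p))" .
  moreover have "- (r - \<alpha>)\<^sup>2 / (4 * r) < - (\<delta>\<^sup>2 * r)"
  proof -
    have "\<delta>\<^sup>2 * r = (r - \<alpha>)\<^sup>2 / (16 * r)"
      using r by (simp add: \<delta>_def power_divide power2_eq_square)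
    moreover have "(r - \<alpha>)\<^sup>2 / (16 * r) < (r - \<alpha>)\<^sup>2 / (4 * r)"
      using r assms(3) by (intro divide_strict_left_mono) auto
    ultimately show ?thesis by simp
  qed
  ultimately show ?thesis
    unfolding h_def A_def s_def by (meson ereal_less(2) less_ereal.simps(1) less_le_trans)
qed

end
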